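(* Let $p>1$, $p^*=\frac{p}{p-1}$, let $\gamma\ge 0$ be real, and let $\Omega\subset\mathbb{R}^{N+l}$ ($N+l\ge 3$) be a bounded open domain. For any $g\in L^{p^*}(\Omega)$ there exists at least one function $u\in W^{1,p}_{\lambda,0}(\Omega)$ such that $$I(u)=\inf_{v\in W^{1,p}_{\lambda,0}(\Omega)} I(v),$$ where $$I(v)=\frac1p\int_\Omega|\nabla_\gamma v|^p\,dz-\int_\Omega g(z)\,v\,dz .$$
   Context: Points of $\mathbb{R}^{N+l}$ are written $z=(x,y)=(x_1,\dots,x_N,y_1,\dots,y_l)$. The Grushin gradient is $\nabla_\gamma u=(\nabla_x u,\,|x|^\gamma\nabla_y u)$. For $p\ge1$, $$W^{1,p}_\lambda(\Omega)=\Big\{u\in L^p(\Omega): \tfrac{\partial u}{\partial x_i},\ |x|^\gamma\tfrac{\partial u}{\partial y_j}\in L^p(\Omega),\ i=1,\dots,N,\ j=1,\dots,l\Big\},$$ with norm $\|u\|_{W^{1,p}_\lambda(\Omega)}=\big(\int_\Omega|\nabla_\gamma u|^p+|u|^p\,dz\big)^{1/p}$, and $W^{1,p}_{\lambda,0}(\Omega)$ is the closure of $C_0^\infty(\Omega)$ in $W^{1,p}_\lambda(\Omega)$ with respect to this norm. *)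

theory Defs
  imports "HOL-Analysis.Analysis"
begin

text \<open>
  Points \<open>z = (x, y)\<close> of \<open>\<real>\<^sup>N\<^sup>+\<^sup>l\<close> are elements of \<open>(real ^ 'n) \<times> (real ^ 'l)\<close>, with
  \<open>N = CARD('n)\<close> and \<open>l = CARD('l)\<close>; the product norm is the Euclidean one. Elements of the function
  spaces are representatives \<open>z \<Rightarrow> real\<close>, whose values outside \<open>\<Omega>\<close> are irrelevant.
\<close>

primrec Ck :: "nat \<Rightarrow> ('a::euclidean_space \<Rightarrow> real) \<Rightarrow> bool" where
  "Ck 0 f \<longleftrightarrow> continuous_on UNIV f"
| "Ck (Suc k) f \<longleftrightarrow> f differentiable_on UNIV \<and> (\<forall>v. Ck k (\<lambda>z. frechet_derivative f (at z) v))"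

text \<open>\<open>C\<^sub>0\<^sup>\<infinity>(\<Omega>)\<close>, each function being extended by \<open>0\<close> to the whole space.\<close>

definition test_functions :: "'a::euclidean_space set \<Rightarrow> ('a \<Rightarrow> real) set" where
  "test_functions \<Omega> =
     {\<phi>. (\<forall>k. Ck k \<phi>) \<and> compact (closure {z. \<phi> z \<noteq> 0}) \<and> closure {z. \<phi> z \<noteq> 0} \<subseteq> \<Omega>}"

definition Lp_space :: "real \<Rightarrow> 'a::euclidean_space set \<Rightarrow> ('a \<Rightarrow> real) set" where
  "Lp_space p \<Omega> =
     {u \<in> borel_measurable (lebesgue_on \<Omega>). integrable (lebesgue_on \<Omega>) (\<lambda>z. \<bar>u z\<bar> powr p)}"

definition locally_integrable_on :: "('a::euclidean_space \<Rightarrow> real) \<Rightarrow> 'a set \<Rightarrow> bool" where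
  "locally_integrable_on u \<Omega> \<longleftrightarrow> (\<forall>K. compact K \<and> K \<subseteq> \<Omega> \<longrightarrow> integrable (lebesgue_on K) u)"

text \<open>
  \<open>w = a \<partial>\<^sub>b u\<close> on \<open>\<Omega>\<close> in the sense of distributions, for a continuous coefficient \<open>a\<close> that does
  not depend on the coordinate in direction \<open>b\<close>, so that no derivative of \<open>a\<close> appears after
  integration by parts. The function \<open>\<partial>\<^sub>b u\<close> itself need not be locally integrable near the
  zeros of \<open>a\<close>.
\<close>

definition has_weak_derivative_along ::
  "('a::euclidean_space \<Rightarrow> real) \<Rightarrow> ('a \<Rightarrow> real) \<Rightarrow> 'a \<Rightarrow> ('a \<Rightarrow> real) \<Rightarrow> 'a set \<Rightarrow> bool" where
  "has_weak_derivative_along u a b w \<Omega> \<longleftrightarrow>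
     locally_integrable_on u \<Omega> \<and> locally_integrable_on w \<Omega> \<and>
     (\<forall>\<phi>\<in>test_functions \<Omega>.
        integral\<^sup>L (lebesgue_on \<Omega>) (\<lambda>z. u z * (a z * frechet_derivative \<phi> (at z) b)) =
        - integral\<^sup>L (lebesgue_on \<Omega>) (\<lambda>z. w z * \<phi> z))"

text \<open>
  The weight \<open>|x|\<^sup>\<gamma>\<close>. The case distinction is needed because \<open>0 powr 0 = 0\<close>, whereas for
  \<open>\<gamma> = 0\<close> the weight is constantly \<open>1\<close>.
\<close>

definition grushin_weight :: "real \<Rightarrow> (real ^ 'n) \<times> (real ^ 'l) \<Rightarrow> real" where
  "grushin_weight \<gamma> z = (if \<gamma> = 0 then 1 else norm (fst z) powr \<gamma>)"

definition has_grushin_gradient ::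
  "((real ^ 'n) \<times> (real ^ 'l) \<Rightarrow> real) \<Rightarrow> real \<Rightarrow>
   ((real ^ 'n) \<times> (real ^ 'l) \<Rightarrow> (real ^ 'n) \<times> (real ^ 'l)) \<Rightarrow>
   ((real ^ 'n) \<times> (real ^ 'l)) set \<Rightarrow> bool" where
  "has_grushin_gradient u \<gamma> G \<Omega> \<longleftrightarrow>
     (\<forall>i. has_weak_derivative_along u (\<lambda>_. 1) (axis i 1, 0) (\<lambda>z. fst (G z) $ i) \<Omega>) \<and>
     (\<forall>j. has_weak_derivative_along u (grushin_weight \<gamma>) (0, axis j 1) (\<lambda>z. snd (G z) $ j) \<Omega>)"

text \<open>
  \<open>\<nabla>\<^sub>\<gamma> u\<close> on \<open>\<Omega>\<close>. A weak gradient is determined up to a null set, so the choice does not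
  affect the integrals below; the value is meaningful only if a weak gradient exists.
\<close>

definition grushin_gradient ::
  "real \<Rightarrow> ((real ^ 'n) \<times> (real ^ 'l)) set \<Rightarrow> ((real ^ 'n) \<times> (real ^ 'l) \<Rightarrow> real) \<Rightarrow>
   (real ^ 'n) \<times> (real ^ 'l) \<Rightarrow> (real ^ 'n) \<times> (real ^ 'l)" where
  "grushin_gradient \<gamma> \<Omega> u = (SOME G. has_grushin_gradient u \<gamma> G \<Omega>)"

definition W_space ::
  "real \<Rightarrow> real \<Rightarrow> ((real ^ 'n) \<times> (real ^ 'l)) set \<Rightarrow> ((real ^ 'n) \<times> (real ^ 'l) \<Rightarrow> real) set" where
  "W_space p \<gamma> \<Omega> =
     {u \<in> Lp_space p \<Omega>. \<exists>G. has_grushin_gradient u \<gamma> G \<Omega> \<and>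
        (\<forall>i. (\<lambda>z. fst (G z) $ i) \<in> Lp_space p \<Omega>) \<and>
        (\<forall>j. (\<lambda>z. snd (G z) $ j) \<in> Lp_space p \<Omega>)}"

definition W_norm ::
  "real \<Rightarrow> real \<Rightarrow> ((real ^ 'n) \<times> (real ^ 'l)) set \<Rightarrow> ((real ^ 'n) \<times> (real ^ 'l) \<Rightarrow> real) \<Rightarrow> real" where
  "W_norm p \<gamma> \<Omega> u =
     (integral\<^sup>L (lebesgue_on \<Omega>)
        (\<lambda>z. norm (grushin_gradient \<gamma> \<Omega> u z) powr p + \<bar>u z\<bar> powr p)) powr (1 / p)"

definition W0_space ::
  "real \<Rightarrow> real \<Rightarrow> ((real ^ 'n) \<times> (real ^ 'l)) set \<Rightarrow> ((real ^ 'n) \<times> (real ^ 'l) \<Rightarrow> real) set" where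
  "W0_space p \<gamma> \<Omega> =
     {u \<in> W_space p \<gamma> \<Omega>.
        \<forall>\<epsilon>>0. \<exists>\<phi>\<in>test_functions \<Omega>. W_norm p \<gamma> \<Omega> (\<lambda>z. u z - \<phi> z) < \<epsilon>}"

definition grushin_energy ::
  "real \<Rightarrow> real \<Rightarrow> ((real ^ 'n) \<times> (real ^ 'l)) set \<Rightarrow> ((real ^ 'n) \<times> (real ^ 'l) \<Rightarrow> real) \<Rightarrow>
   ((real ^ 'n) \<times> (real ^ 'l) \<Rightarrow> real) \<Rightarrow> real" where
  "grushin_energy p \<gamma> \<Omega> g v =
     1 / p * integral\<^sup>L (lebesgue_on \<Omega>) (\<lambda>z. norm (grushin_gradient \<gamma> \<Omega> v z) powr p) -
     integral\<^sup>L (lebesgue_on \<Omega>) (\<lambda>z. g z * v z)"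

end

theory Submission imports Defs begin

text \<open>
  The minimizer is constructed by the direct method, with uniform convexity in place of weak
  compactness. On a bounded set, integration by parts against a single coordinate of \<open>x\<close> gives a
  Poincare inequality for test functions (\<open>poincare_grushin\<close>), and with Young's inequality it makes
  the energy bounded below and coercive (\<open>test_energy_coercive\<close>). Let \<open>J\<close> be the infimum of the
  energy over test functions and let \<open>\<phi>\<^sub>n\<close> be a minimizing sequence of test functions. The energy of
  the midpoint of \<open>\<phi>\<^sub>m\<close> and \<open>\<phi>\<^sub>n\<close> is at least \<open>J\<close>; hence the convexity defect
  \<open>(|a|\<^sup>p + |b|\<^sup>p) / 2 - |(a + b) / 2|\<^sup>p\<close> of the two gradients has a small integral. Uniform convexity
  of \<open>|\<cdot>|\<^sup>p\<close> for \<open>p > 1\<close> (\<open>norm_powr_uniformly_convex\<close>) bounds \<open>|a - b|\<^sup>p\<close> by this defect, so the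
  gradients are Cauchy in \<open>L\<^sup>p\<close> (\<open>minimizing_sequence_cauchy\<close>), and the functions are Cauchy by the
  Poincare inequality. By completeness of \<open>L\<^sup>p\<close> (\<open>powr_norm_complete\<close>) they converge strongly; the
  limit \<open>u\<close> lies in the closure of the test functions, since weak differentiation is a closed
  operation, and its energy is \<open>J\<close>, since the energy is continuous for this convergence. The same
  continuity shows that every element of the closure has energy at least \<open>J\<close>.

  The gradient of a function is fixed by a choice operator, so all of this needs that weak gradients
  are unique almost everywhere. This is the fundamental lemma of the calculus of variations
  (\<open>AE_zero_if_orthogonal_to_test_functions\<close>), which rests on explicit smooth functions that
  increase to the indicator of a box. Throughout, \<open>L\<^sup>p\<close> convergence is expressed by the integral of
  the \<open>p\<close>-th power of the distance, so that Minkowski's inequality is never used.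
\<close>

section \<open>Smooth functions\<close>

lemma Ck_Suc_iff_has_derivative:
  assumes "\<And>z. (f has_derivative f' z) (at z)"
  shows "Ck (Suc k) f \<longleftrightarrow> (\<forall>v. Ck k (\<lambda>z. f' z v))"
proof -
  have "frechet_derivative f (at z) = f' z" for z
    using frechet_derivative_at[OF assms] by simp
  moreover have "f differentiable_on UNIV"
    using assms unfolding differentiable_on_def differentiable_def by blast
  ultimately show ?thesis by simp
qed

lemma Ck_Suc_has_derivative:
  assumes "Ck (Suc k) f"
  shows "(f has_derivative frechet_derivative f (at z)) (at z)"
  using assms by (simp add: differentiable_on_def frechet_derivative_works[symmetric])

lemma Ck_SucD: "Ck (Suc k) f \<Longrightarrow> Ck k f"
proof (induction k arbitrary: f)
  case 0
  then show ?case by (auto intro: differentiable_imp_continuous_on)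
next
  case (Suc k)
  then show ?case by (metis Ck.simps(2))
qed

lemma Ck_const: "Ck k (\<lambda>_::'a::euclidean_space. c)"
proof (induction k arbitrary: c)
  case (Suc k)
  have "((\<lambda>_::'a. c) has_derivative (\<lambda>_. 0)) (at z)" for z by simp
  from Ck_Suc_iff_has_derivative[OF this] Suc show ?case by blast
qed simp

lemma Ck_add:
  assumes "Ck k f" and "Ck k g"
  shows "Ck k (\<lambda>z. f z + g z)"
  using assms
proof (induction k arbitrary: f g)
  case 0
  then show ?case by (simp add: continuous_on_add)
next
  case (Suc k)
  have "((\<lambda>z. f z + g z) has_derivative
      (\<lambda>v. frechet_derivative f (at z) v + frechet_derivative g (at z) v)) (at z)" for z
    by (intro has_derivative_add Ck_Suc_has_derivative[OF Suc.prems(1)]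
        Ck_Suc_has_derivative[OF Suc.prems(2)])
  from Ck_Suc_iff_has_derivative[OF this] Suc show ?case by simp
qed

lemma Ck_mult:
  assumes "Ck k f" and "Ck k g"
  shows "Ck k (\<lambda>z. f z * g z)"
  using assms
proof (induction k arbitrary: f g)
  case 0
  then show ?case by (simp add: continuous_on_mult)
next
  case (Suc k)
  have "((\<lambda>z. f z * g z) has_derivative
      (\<lambda>v. f z * frechet_derivative g (at z) v + frechet_derivative f (at z) v * g z)) (at z)" for z
    by (intro has_derivative_mult Ck_Suc_has_derivative[OF Suc.prems(1)]
        Ck_Suc_has_derivative[OF Suc.prems(2)])
  from Ck_Suc_iff_has_derivative[OF this] Suc Ck_SucD[OF Suc.prems(1)] Ck_SucD[OF Suc.prems(2)]
  show ?case by (simp add: Ck_add)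
qed

lemma Ck_prod:
  assumes "finite I" and "\<And>i. i \<in> I \<Longrightarrow> Ck k (f i)"
  shows "Ck k (\<lambda>z. \<Prod>i\<in>I. f i z)"
  using assms by (induction I rule: finite_induct) (auto intro: Ck_const Ck_mult)

text \<open>
  The classical flat function and its companions \<open>exp (- 1 / t) / t ^ n\<close>, extended by \<open>0\<close> to
  \<open>t \<le> 0\<close>. The derivative of the \<open>n\<close>-th function is a combination of the functions with the
  indices \<open>n + 2\<close> and \<open>n + 1\<close>, so the family is closed under differentiation.
\<close>

definition flat_exp :: "nat \<Rightarrow> real \<Rightarrow> real" where
  "flat_exp n t = (if t > 0 then exp (- 1 / t) / t ^ n else 0)"

lemma flat_exp_tendsto_0: "(flat_exp n \<longlongrightarrow> 0) (at 0)"
proof -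
  have right: "((\<lambda>t::real. exp (- 1 / t) / t ^ n) \<longlongrightarrow> 0) (at_right 0)"
  proof -
    have "((\<lambda>s::real. s ^ n / exp s) \<longlongrightarrow> 0) at_top"
      by (rule tendsto_power_div_exp_0)
    then have "((\<lambda>t::real. (inverse t) ^ n / exp (inverse t)) \<longlongrightarrow> 0) (at_right 0)"
      by (rule filterlim_compose[OF _ filterlim_inverse_at_top_right])
    moreover have "(\<lambda>t::real. (inverse t) ^ n / exp (inverse t)) = (\<lambda>t. exp (- 1 / t) / t ^ n)"
      by (auto simp: fun_eq_iff field_simps exp_minus)
    ultimately show ?thesis by simp
  qed
  have "(flat_exp n \<longlongrightarrow> 0) (at_right 0)"
    by (rule Lim_transform_eventually[OF right])
       (auto simp: flat_exp_def eventually_at_right_less eventually_mono[OF eventually_at_right_less[of 0]])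
  moreover have "(flat_exp n \<longlongrightarrow> 0) (at_left 0)"
    by (rule Lim_transform_eventually[OF tendsto_const])
       (auto simp: flat_exp_def eventually_at_filter)
  ultimately show ?thesis
    by (simp add: filterlim_split_at)
qed

lemma has_derivative_flat_exp:
  "(flat_exp n has_real_derivative flat_exp (n + 2) t - real n * flat_exp (n + 1) t) (at t)"
proof (cases t "0::real" rule: linorder_cases)
  case less
  have "((\<lambda>_. 0) has_real_derivative 0) (at t)" by simp
  then have "(flat_exp n has_real_derivative 0) (at t)"
    by (rule DERIV_cong_ev[THEN iffD1, OF refl _ refl, rotated])
       (use less in \<open>auto simp: flat_exp_def eventually_nhds intro!: exI[of _ "{..<0}"]\<close>)
  with less show ?thesis by (simp add: flat_exp_def)
next
  case equal
  have "((\<lambda>h. (flat_exp n (0 + h) - flat_exp n 0) / h) \<longlongrightarrow> 0) (at 0)"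
    by (rule Lim_transform_eventually[OF flat_exp_tendsto_0[of "Suc n"]])
       (auto simp: flat_exp_def eventually_at_filter)
  with equal show ?thesis by (simp add: DERIV_def flat_exp_def)
next
  case greater
  have "((\<lambda>t. exp (- 1 / t) / t ^ n) has_real_derivative
      (exp (- 1 / t) * (1 / t\<^sup>2) * t ^ n - exp (- 1 / t) * (real n * t ^ (n - 1))) / (t ^ n * t ^ n)) (at t)"
    using greater by (auto intro!: derivative_eq_intros simp: power2_eq_square)
  also have "(exp (- 1 / t) * (1 / t\<^sup>2) * t ^ n - exp (- 1 / t) * (real n * t ^ (n - 1))) / (t ^ n * t ^ n)
      = exp (- 1 / t) / t ^ (n + 2) - real n * (exp (- 1 / t) / t ^ (n + 1))"
    using greater by (cases n) (auto simp: field_simps power2_eq_square)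
  finally have "(flat_exp n has_real_derivative
      exp (- 1 / t) / t ^ (n + 2) - real n * (exp (- 1 / t) / t ^ (n + 1))) (at t)"
    by (rule DERIV_cong_ev[THEN iffD1, OF refl _ refl, rotated])
       (use greater in \<open>auto simp: flat_exp_def eventually_nhds intro!: exI[of _ "{0<..}"]\<close>)
  with greater show ?thesis by (simp add: flat_exp_def)
qed

lemma Ck_flat_exp_affine: "Ck k (\<lambda>z. flat_exp n (z \<bullet> b + c))"
proof (induction k arbitrary: n)
  case 0
  have "continuous_on UNIV (flat_exp n)"
    by (intro DERIV_continuous_on[OF has_derivative_flat_exp[THEN DERIV_subset]]) auto
  then have "continuous_on UNIV (\<lambda>z. flat_exp n (z \<bullet> b + c))"
    by (rule continuous_on_compose2[of UNIV "flat_exp n" UNIV "\<lambda>z. z \<bullet> b + c"])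
       (auto intro!: continuous_intros)
  then show ?case by simp
next
  case (Suc k)
  have deriv: "((\<lambda>z. flat_exp n (z \<bullet> b + c)) has_derivative
    (\<lambda>v. (flat_exp (n + 2) (z \<bullet> b + c) + (- real n) * flat_exp (n + 1) (z \<bullet> b + c)) * (v \<bullet> b))) (at z)" for z
  proof -
    have "((\<lambda>z. z \<bullet> b + c) has_derivative (\<lambda>v. v \<bullet> b)) (at z)"
      by (auto intro!: derivative_eq_intros)
    from DERIV_compose_FDERIV[OF has_derivative_flat_exp this] show ?thesis
      by (simp add: mult.commute)
  qed
  show ?case
    unfolding Ck_Suc_iff_has_derivative[OF deriv]
    by (intro allI Ck_mult Ck_const Ck_add Suc)
qed

text \<open>
  Smooth functions with values in \<open>[0, 1]\<close>, zero outside the open box with corners \<open>l\<close> and \<open>u\<close>, that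
  increase with \<open>k\<close> to the indicator of this box.
\<close>

definition box_bump :: "'a::euclidean_space \<Rightarrow> 'a \<Rightarrow> nat \<Rightarrow> 'a \<Rightarrow> real" where
  "box_bump l u k z = (\<Prod>b\<in>Basis. flat_exp 0 (real (Suc k) * (z \<bullet> b - l \<bullet> b)) *
                                   flat_exp 0 (real (Suc k) * (u \<bullet> b - z \<bullet> b)))"

lemma flat_exp_0_bounds: "0 \<le> flat_exp 0 t" "flat_exp 0 t \<le> 1"
  by (auto simp: flat_exp_def)

lemma box_bump_bounds: "0 \<le> box_bump l u k z" "box_bump l u k z \<le> 1"
  unfolding box_bump_def
  by (auto intro!: prod_nonneg prod_le_1 mult_nonneg_nonneg mult_le_one simp: flat_exp_0_bounds)

lemma box_bump_eq_0: "z \<notin> box l u \<Longrightarrow> box_bump l u k z = 0"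
  by (auto simp: box_bump_def mem_box flat_exp_def zero_less_mult_iff)

lemma box_bump_tendsto: "(\<lambda>k. box_bump l u k z) \<longlonglongrightarrow> indicator (box l u) z"
proof (cases "z \<in> box l u")
  case True
  have lim: "(\<lambda>k. flat_exp 0 (real (Suc k) * t)) \<longlonglongrightarrow> 1" if "t > 0" for t
  proof -
    have "(\<lambda>k. exp (- (1 / t) * inverse (real (Suc k)))) \<longlonglongrightarrow> exp (- (1 / t) * 0)"
      by (intro tendsto_intros LIMSEQ_inverse_real_of_nat)
    then show ?thesis
      using that by (simp add: flat_exp_def divide_inverse mult_ac)
  qed
  have "(\<lambda>k. box_bump l u k z) \<longlonglongrightarrow> (\<Prod>b\<in>(Basis::'a set). 1 * 1)"
    unfolding box_bump_def using True
    by (intro tendsto_prod tendsto_mult lim) (auto simp: mem_box)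
  with True show ?thesis by simp
qed (simp add: box_bump_eq_0)

lemma box_bump_test_function:
  assumes "cbox l u \<subseteq> \<Omega>"
  shows "box_bump l u k \<in> test_functions \<Omega>"
proof -
  have "Ck m (box_bump l u k)" for m
  proof -
    have "Ck m (\<lambda>z. flat_exp 0 (z \<bullet> (real (Suc k) *\<^sub>R b) + (- real (Suc k) * (l \<bullet> b))) *
        flat_exp 0 (z \<bullet> (- real (Suc k) *\<^sub>R b) + real (Suc k) * (u \<bullet> b)))" for b
      by (intro Ck_mult Ck_flat_exp_affine)
    then have "Ck m (\<lambda>z. \<Prod>b\<in>Basis. flat_exp 0 (z \<bullet> (real (Suc k) *\<^sub>R b) + (- real (Suc k) * (l \<bullet> b))) *
        flat_exp 0 (z \<bullet> (- real (Suc k) *\<^sub>R b) + real (Suc k) * (u \<bullet> b)))"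
      by (intro Ck_prod) auto
    then show ?thesis
      by (simp add: box_bump_def[abs_def] algebra_simps)
  qed
  moreover have "{z. box_bump l u k z \<noteq> 0} \<subseteq> cbox l u"
    using box_bump_eq_0[of _ l u k] box_subset_cbox[of l u] by blast
  then have "closure {z. box_bump l u k z \<noteq> 0} \<subseteq> cbox l u"
    by (rule closure_minimal[OF _ closed_cbox])
  ultimately show ?thesis
    using assms bounded_subset[OF bounded_cbox[of l u]]
    by (auto simp: test_functions_def compact_eq_bounded_closed)
qed

section \<open>Test functions\<close>

lemma test_function_has_derivative:
  assumes "\<phi> \<in> test_functions \<Omega>"
  shows "(\<phi> has_derivative frechet_derivative \<phi> (at z)) (at z)"
proof -
  have "Ck (Suc 0) \<phi>" using assms unfolding test_functions_def by blast
  then show ?thesis by (rule Ck_Suc_has_derivative)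
qed

lemma test_function_continuous: "\<phi> \<in> test_functions \<Omega> \<Longrightarrow> continuous_on S \<phi>"
  by (rule continuous_on_subset[OF _ subset_UNIV]) (auto simp: test_functions_def dest: spec[of _ 0])

lemma test_function_derivative_continuous:
  assumes "\<phi> \<in> test_functions \<Omega>"
  shows "continuous_on S (\<lambda>z. frechet_derivative \<phi> (at z) v)"
proof -
  have "Ck (Suc 0) \<phi>" using assms by (auto simp: test_functions_def)
  then have "continuous_on UNIV (\<lambda>z. frechet_derivative \<phi> (at z) v)" by simp
  then show ?thesis by (rule continuous_on_subset) simp
qed

lemma test_function_support:
  assumes "\<phi> \<in> test_functions \<Omega>"
  obtains K where "compact K" "K \<subseteq> \<Omega>" "\<And>z. z \<notin> K \<Longrightarrow> \<phi> z = 0"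
    "\<And>z v. z \<notin> K \<Longrightarrow> frechet_derivative \<phi> (at z) v = 0"
proof -
  define K where "K = closure {z. \<phi> z \<noteq> 0}"
  have K: "compact K" "K \<subseteq> \<Omega>" using assms by (auto simp: test_functions_def K_def)
  have zero: "\<phi> z = 0" if "z \<notin> K" for z
    using that closure_subset[of "{z. \<phi> z \<noteq> 0}"] unfolding K_def by blast
  have "frechet_derivative \<phi> (at z) v = 0" if z: "z \<notin> K" for z v
  proof -
    have "((\<lambda>_. 0) has_derivative (\<lambda>_. 0)) (at z)" by simp
    then have "(\<phi> has_derivative (\<lambda>_. 0)) (at z)"
      by (rule has_derivative_transform_within_open[where s="- K"])
         (use z zero K(1) in \<open>auto simp: open_Compl compact_imp_closed\<close>)
    then have "frechet_derivative \<phi> (at z) = (\<lambda>_. 0)" by (rule frechet_derivative_at[symmetric])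
    then show ?thesis by simp
  qed
  with K zero show ?thesis using that by blast
qed

lemma test_function_linear_combination:
  assumes "\<phi> \<in> test_functions \<Omega>" and "\<psi> \<in> test_functions \<Omega>"
  shows "(\<lambda>z. a * \<phi> z + b * \<psi> z) \<in> test_functions \<Omega>" (is "?f \<in> _")
    and "frechet_derivative (\<lambda>z. a * \<phi> z + b * \<psi> z) (at z) v =
      a * frechet_derivative \<phi> (at z) v + b * frechet_derivative \<psi> (at z) v"
proof -
  have "closure {z. ?f z \<noteq> 0} \<subseteq> closure ({z. \<phi> z \<noteq> 0} \<union> {z. \<psi> z \<noteq> 0})"
    by (intro closure_mono) auto
  then have sub: "closure {z. ?f z \<noteq> 0} \<subseteq> closure {z. \<phi> z \<noteq> 0} \<union> closure {z. \<psi> z \<noteq> 0}"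
    by (simp add: closure_Un)
  have \<phi>: "compact (closure {z. \<phi> z \<noteq> 0})" "closure {z. \<phi> z \<noteq> 0} \<subseteq> \<Omega>" "Ck k \<phi>"
    and \<psi>: "compact (closure {z. \<psi> z \<noteq> 0})" "closure {z. \<psi> z \<noteq> 0} \<subseteq> \<Omega>" "Ck k \<psi>" for k
    using assms unfolding test_functions_def by blast+
  have "compact (closure {z. ?f z \<noteq> 0})"
    using compact_Int_closed[OF compact_Un[OF \<phi>(1) \<psi>(1)] closed_closure[of "{z. ?f z \<noteq> 0}"]]
    unfolding Int_absorb1[OF sub] .
  moreover have "Ck k ?f" for k
    by (intro Ck_add Ck_mult Ck_const \<phi> \<psi>)
  ultimately show "?f \<in> test_functions \<Omega>"
    unfolding test_functions_def using sub \<phi>(2) \<psi>(2) by blast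
  have "(?f has_derivative (\<lambda>v. a * frechet_derivative \<phi> (at z) v + b * frechet_derivative \<psi> (at z) v)) (at z)"
    using assms by (intro has_derivative_add has_derivative_mult_right test_function_has_derivative)
  from fun_cong[OF frechet_derivative_at[OF this, symmetric]]
  show "frechet_derivative ?f (at z) v =
      a * frechet_derivative \<phi> (at z) v + b * frechet_derivative \<psi> (at z) v" .
qed

section \<open>The fundamental lemma of the calculus of variations\<close>

text \<open>Boxes are stable under intersection and generate the Borel sets.\<close>

lemma AE_zero_if_box_integrals_zero:
  fixes f :: "'a::euclidean_space \<Rightarrow> real"
  assumes f: "integrable lborel f"
    and box: "\<And>l u. set_lebesgue_integral lborel (box l u) f = 0"
  shows "AE z in lborel. f z = 0"
proof -
  have int: "set_integrable lborel A f" if "A \<in> sets borel" for A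
    using integrable_mult_indicator[OF _ f, of A] that by (simp add: set_integrable_def)
  have UNIV: "integral\<^sup>L lborel f = 0"
  proof -
    \<comment> \<open>closure under complements needs the integral over the whole space\<close>
    let ?B = "\<lambda>n::nat. box (- (real n *\<^sub>R One)) (real n *\<^sub>R One) :: 'a set"
    have "(\<lambda>n. set_lebesgue_integral lborel (?B n) f) \<longlonglongrightarrow> set_lebesgue_integral lborel (\<Union>n. ?B n) f"
    proof (rule set_integral_cont_up)
      show "incseq ?B"
        by (intro monoI subset_box_imp) auto
    qed (auto intro: int)
    then have "set_lebesgue_integral lborel UNIV f = 0"
      using box by (simp add: UN_box_eq_UNIV LIMSEQ_const_iff)
    then show ?thesis by (simp add: set_lebesgue_integral_def)
  qed
  have "set_lebesgue_integral lborel A f = 0" if "A \<in> sets borel" for A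
  proof -
    let ?E = "range (\<lambda>(a, b). box a b :: 'a set)"
    have "Int_stable ?E"
      by (auto simp: Int_stable_def box_Int_box)
    moreover have "?E \<subseteq> Pow UNIV" by simp
    moreover have "A \<in> sigma_sets UNIV ?E"
      using that by (simp add: borel_eq_box)
    ultimately show ?thesis
    proof (induction rule: sigma_sets_induct_disjoint)
      case (basic A)
      then show ?case using box by auto
    next
      case empty
      show ?case by (simp add: set_lebesgue_integral_def)
    next
      case (compl A)
      then have A: "A \<in> sets borel" by (simp add: borel_eq_box)
      have "set_lebesgue_integral lborel (A \<union> (UNIV - A)) f =
          set_lebesgue_integral lborel A f + set_lebesgue_integral lborel (UNIV - A) f"
        using A by (intro set_integral_Un int) auto
      with compl UNIV show ?case by (simp add: set_lebesgue_integral_def)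
    next
      case (union A)
      then have A: "A i \<in> sets borel" for i by (auto simp: borel_eq_box)
      have "set_lebesgue_integral lborel (\<Union>i. A i) f = (\<Sum>i. set_lebesgue_integral lborel (A i) f)"
        using A union by (intro lebesgue_integral_countable_add int) (auto simp: disjoint_family_on_def)
      with union show ?case by simp
    qed
  qed
  then show ?thesis
    using f density_unique_real[of lborel f "\<lambda>_. 0"] by (simp add: set_lebesgue_integral_def)
qed

lemma integrable_locally_times_continuous:
  fixes w h :: "'a::euclidean_space \<Rightarrow> real"
  assumes w: "locally_integrable_on w \<Omega>" and \<Omega>: "\<Omega> \<in> sets lebesgue"
    and K: "compact K" "K \<subseteq> \<Omega>" "\<And>z. z \<notin> K \<Longrightarrow> h z = 0" and h: "continuous_on UNIV h"
  shows "integrable (lebesgue_on \<Omega>) (\<lambda>z. w z * h z)"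
proof -
  have Ks: "K \<in> sets lebesgue" using K(1) by (simp add: lmeasurable_compact fmeasurableD)
  obtain B where B: "\<And>z. z \<in> K \<Longrightarrow> norm (h z) \<le> B"
    using compact_imp_bounded[OF compact_continuous_image[OF continuous_on_subset[OF h subset_UNIV] K(1)]]
    by (auto simp: bounded_iff)
  have iK: "integrable (lebesgue_on K) w" using w K by (auto simp: locally_integrable_on_def)
  have "integrable (lebesgue_on K) (\<lambda>z. w z * h z)"
  proof (rule Bochner_Integration.integrable_bound)
    show "integrable (lebesgue_on K) (\<lambda>z. B * w z)" using iK by simp
    show "(\<lambda>z. w z * h z) \<in> borel_measurable (lebesgue_on K)"
      using iK continuous_imp_measurable_on_sets_lebesgue[OF continuous_on_subset[OF h subset_UNIV] Ks]
      by (intro borel_measurable_times) auto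
    show "AE z in lebesgue_on K. norm (w z * h z) \<le> norm (B * w z)"
    proof (intro AE_I2)
      fix z assume "z \<in> space (lebesgue_on K)"
      then have "\<bar>h z\<bar> * \<bar>w z\<bar> \<le> \<bar>B\<bar> * \<bar>w z\<bar>"
        using B[of z] by (intro mult_right_mono) auto
      then show "norm (w z * h z) \<le> norm (B * w z)"
        by (simp add: abs_mult mult.commute)
    qed
  qed
  then have "integrable lebesgue (\<lambda>z. if z \<in> K then w z * h z else 0)"
    by (simp add: Lebesgue_Measure.integrable_restrict_UNIV Ks)
  also have "(\<lambda>z. if z \<in> K then w z * h z else 0) = (\<lambda>z. if z \<in> \<Omega> then w z * h z else 0)"
    using K by (auto simp: fun_eq_iff)
  finally show ?thesis by (simp add: Lebesgue_Measure.integrable_restrict_UNIV \<Omega>)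
qed

text \<open>
  The fundamental lemma. Testing with \<open>box_bump\<close> and passing to the limit, the integral of \<open>w\<close> over
  every box inside \<open>\<Omega>\<close> vanishes. Locally, \<open>w\<close> is cut off to an open box, so that an arbitrary box may
  be replaced by its intersection with this one.
\<close>

lemma AE_zero_if_orthogonal_to_test_functions:
  fixes w :: "'a::euclidean_space \<Rightarrow> real"
  assumes \<Omega>: "open \<Omega>" and w: "locally_integrable_on w \<Omega>"
    and orth: "\<And>\<phi>. \<phi> \<in> test_functions \<Omega> \<Longrightarrow> integral\<^sup>L (lebesgue_on \<Omega>) (\<lambda>z. w z * \<phi> z) = 0"
  shows "AE z in lebesgue_on \<Omega>. w z = 0"
proof -
  have \<Omega>s: "\<Omega> \<in> sets lebesgue" using \<Omega> by auto
  have cbox: "AE z in lebesgue. z \<in> cbox c d \<longrightarrow> w z = 0" if cd: "cbox c d \<subseteq> \<Omega>" for c d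
  proof -
    define f where "f z = indicator (box c d) z * w z" for z
    have "integrable (lebesgue_on (cbox c d)) w"
      using w cd by (auto simp: locally_integrable_on_def)
    then have "integrable lebesgue (\<lambda>z. indicator (cbox c d) z *\<^sub>R w z)"
      by (subst (asm) integrable_restrict_space) auto
    then have "integrable lebesgue (\<lambda>z. indicator (box c d) z *\<^sub>R (indicator (cbox c d) z *\<^sub>R w z))"
      by (rule integrable_mult_indicator[rotated]) auto
    also have "(\<lambda>z. indicator (box c d) z *\<^sub>R (indicator (cbox c d) z *\<^sub>R w z)) = f"
      using box_subset_cbox[of c d] by (auto simp: f_def fun_eq_iff indicator_def)
    finally have f: "integrable lebesgue f" .
    obtain f' where f': "f' \<in> borel_measurable lborel" "AE z in lborel. f z = f' z"
      using completion_ex_borel_measurable_real[OF borel_measurable_integrable[OF f]] by blast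
    have ae: "AE z in lebesgue. f z = f' z" using f'(2) by (rule AE_completion)
    have f'm: "f' \<in> borel_measurable lebesgue" using f'(1) by (rule measurable_completion)
    have f'i: "integrable lborel f'"
      using integrable_cong_AE[OF borel_measurable_integrable[OF f] f'm ae] f integrable_completion[OF f'(1)]
      by simp
    have "set_lebesgue_integral lborel (box l u) f' = 0" for l u
    proof -
      obtain l' u' where lu: "box l u \<inter> box c d = box l' u'"
        unfolding box_Int_box by blast
      have "set_lebesgue_integral lborel (box l u) f' = integral\<^sup>L lebesgue (\<lambda>z. indicator (box l u) z *\<^sub>R f' z)"
        unfolding set_lebesgue_integral_def using f'(1) by (intro integral_completion[symmetric]) auto
      also have "\<dots> = integral\<^sup>L lebesgue (\<lambda>z. indicator (box l u) z *\<^sub>R f z)"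
        by (rule integral_cong_AE) (use ae f'm f in \<open>auto intro!: borel_measurable_times borel_measurable_indicator\<close>)
      also have "\<dots> = integral\<^sup>L lebesgue (\<lambda>z. w z * indicator (box l' u') z)"
        by (intro Bochner_Integration.integral_cong) (auto simp: f_def lu[symmetric] indicator_def)
      also have "\<dots> = 0"
      proof (cases "box l' u' = {}")
        case False
        then have sub: "cbox l' u' \<subseteq> cbox c d"
          using lu closure_mono[of "box l' u'" "box c d"] closure_subset
          by (metis closure_box box_eq_empty(1) inf_le2 box_subset_cbox closure_minimal closed_cbox order_trans)
        have test: "box_bump l' u' k \<in> test_functions \<Omega>" for k
          using sub cd by (intro box_bump_test_function) auto
        have eq: "(\<lambda>z. if z \<in> \<Omega> then w z * box_bump l' u' k z else 0) = (\<lambda>z. f z * box_bump l' u' k z)" for k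
        proof
          fix z
          show "(if z \<in> \<Omega> then w z * box_bump l' u' k z else 0) = f z * box_bump l' u' k z"
          proof (cases "z \<in> box l' u'")
            case True
            then have "z \<in> box c d" "z \<in> \<Omega>" using lu box_subset_cbox cd by blast+
            then show ?thesis by (simp add: f_def)
          qed (simp add: box_bump_eq_0)
        qed
        have "integral\<^sup>L lebesgue (\<lambda>z. f z * box_bump l' u' k z) = 0" for k
          using orth[OF test, of k] Lebesgue_Measure.integral_restrict_UNIV[OF \<Omega>s, of "\<lambda>z. w z * box_bump l' u' k z"]
          by (simp add: eq)
        moreover have "(\<lambda>k. integral\<^sup>L lebesgue (\<lambda>z. f z * box_bump l' u' k z)) \<longlonglongrightarrow>
            integral\<^sup>L lebesgue (\<lambda>z. f z * indicator (box l' u') z)"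
        proof (rule integral_dominated_convergence)
          have "box_bump l' u' k \<in> borel_measurable lebesgue" for k
            using test_function_continuous[OF test, of UNIV k]
            by (intro measurable_completion) (auto intro: borel_measurable_continuous_onI)
          then show "(\<lambda>z. f z * box_bump l' u' k z) \<in> borel_measurable lebesgue" for k
            using f by (intro borel_measurable_times) auto
          show "integrable lebesgue (\<lambda>z. \<bar>f z\<bar>)" using f by simp
          show "AE z in lebesgue. norm (f z * box_bump l' u' k z) \<le> \<bar>f z\<bar>" for k
            using box_bump_bounds[of l' u' k] by (auto simp: abs_mult mult_left_le)
          have "indicator (box l' u') \<in> borel_measurable (lebesgue :: 'a measure)"
            by (intro borel_measurable_indicator) auto
          then show "(\<lambda>z. f z * indicator (box l' u') z) \<in> borel_measurable lebesgue"
            using f by (intro borel_measurable_times) auto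
        qed (auto intro!: tendsto_mult box_bump_tendsto)
        ultimately have "integral\<^sup>L lebesgue (\<lambda>z. f z * indicator (box l' u') z) = 0"
          by (simp add: LIMSEQ_const_iff)
        moreover have "(\<lambda>z. f z * indicator (box l' u') z) = (\<lambda>z. w z * indicator (box l' u') z)"
          using lu by (auto simp: f_def indicator_def fun_eq_iff)
        ultimately show ?thesis by simp
      qed simp
      finally show ?thesis .
    qed
    from AE_completion[OF AE_zero_if_box_integrals_zero[OF f'i this]] ae
    have "AE z in lebesgue. f z = 0" by eventually_elim simp
    moreover have "AE z in lebesgue. z \<notin> cbox c d - box c d"
      using negligible_frontier_interval[of c d] by (intro AE_not_in) (simp add: negligible_iff_null_sets)
    ultimately show ?thesis
      by eventually_elim (auto simp: f_def)
  qed
  obtain \<D> where \<D>: "countable \<D>" "\<D> \<subseteq> Pow \<Omega>" "\<And>X. X \<in> \<D> \<Longrightarrow> \<exists>a b. X = cbox a b" "\<Union>\<D> = \<Omega>"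
    using open_countable_Union_open_cbox[OF \<Omega>] by metis
  have "\<forall>X\<in>\<D>. AE z in lebesgue. z \<in> X \<longrightarrow> w z = 0"
    using \<D>(2,3) cbox by blast
  then have "AE z in lebesgue. \<forall>X\<in>\<D>. z \<in> X \<longrightarrow> w z = 0"
    by (rule AE_ball_countable[OF \<D>(1), THEN iffD2])
  then have "AE z in lebesgue. z \<in> \<Omega> \<longrightarrow> w z = 0"
    unfolding \<D>(4)[symmetric] by eventually_elim blast
  then show ?thesis
    using \<Omega>s by (simp add: AE_restrict_space_iff)
qed

section \<open>Integration by parts\<close>

lemma integrable_compact_support:
  fixes f :: "'a::euclidean_space \<Rightarrow> real"
  assumes f: "continuous_on UNIV f" and K: "compact K" "\<And>z. z \<notin> K \<Longrightarrow> f z = 0"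
  shows "integrable lborel f"
proof -
  have "integrable lborel (\<lambda>z. indicator K z *\<^sub>R f z)"
    using K(1) continuous_on_subset[OF f subset_UNIV] by (rule borel_integrable_compact)
  also have "(\<lambda>z. indicator K z *\<^sub>R f z) = f"
    using K(2) by (auto simp: fun_eq_iff indicator_def)
  finally show ?thesis .
qed

lemma locally_integrable_on_continuous:
  fixes f :: "'a::euclidean_space \<Rightarrow> real"
  assumes f: "continuous_on UNIV f"
  shows "locally_integrable_on f \<Omega>"
  unfolding locally_integrable_on_def
proof (intro allI impI)
  fix K :: "'a set" assume K: "compact K \<and> K \<subseteq> \<Omega>"
  have [measurable]: "f \<in> borel_measurable borel"
    using f by (rule borel_measurable_continuous_onI)
  have [measurable]: "K \<in> sets borel" using K by (auto intro: borel_compact)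
  have "integrable lborel (\<lambda>z. indicator K z *\<^sub>R f z)"
    using K continuous_on_subset[OF f subset_UNIV] by (intro borel_integrable_compact) auto
  then have "integrable lebesgue (\<lambda>z. indicator K z *\<^sub>R f z)"
    by (subst integrable_completion) auto
  then show "integrable (lebesgue_on K) f"
    by (subst integrable_restrict_space) auto
qed

lemma integral_lebesgue_on_eq_lborel:
  fixes f :: "'a::euclidean_space \<Rightarrow> real"
  assumes "f \<in> borel_measurable borel" and "\<Omega> \<in> sets lebesgue" and "\<And>z. z \<notin> \<Omega> \<Longrightarrow> f z = 0"
  shows "integral\<^sup>L (lebesgue_on \<Omega>) f = integral\<^sup>L lborel f"
proof -
  have "(\<lambda>z. if z \<in> \<Omega> then f z else 0) = f" using assms(3) by auto
  then show ?thesis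
    using Lebesgue_Measure.integral_restrict_UNIV[OF assms(2), of f] integral_completion[of f lborel] assms(1)
    by simp
qed

lemma integral_lborel_translate:
  fixes f :: "'a::euclidean_space \<Rightarrow> real"
  assumes "f \<in> borel_measurable borel"
  shows "integral\<^sup>L lborel (\<lambda>z. f (z + c)) = integral\<^sup>L lborel f"
proof -
  have "integral\<^sup>L lborel f = integral\<^sup>L (distr lborel borel ((+) c)) f"
    by (simp add: lborel_distr_plus)
  also have "\<dots> = integral\<^sup>L lborel (\<lambda>z. f (c + z))"
    using assms by (intro integral_distr) auto
  finally show ?thesis by (simp add: add.commute)
qed

text \<open>
  The difference quotients of \<open>F\<close> in direction \<open>b\<close> have integral \<open>0\<close> against a weight that is
  invariant under translation along \<open>b\<close>, because Lebesgue measure is translation invariant; they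
  converge boundedly to the derivative. No slicing in the direction \<open>b\<close> is needed.
\<close>

lemma integral_directional_derivative_eq_0:
  fixes F a :: "'a::euclidean_space \<Rightarrow> real"
  assumes F: "\<And>z. (F has_derivative F' z) (at z)" and F': "continuous_on UNIV (\<lambda>z. F' z b)"
    and K: "compact K" "\<And>z. z \<notin> K \<Longrightarrow> F z = 0"
    and a: "continuous_on UNIV a" "\<And>z t. a (z + t *\<^sub>R b) = a z"
  shows "integral\<^sup>L lborel (\<lambda>z. a z * F' z b) = 0"
proof -
  define h where "h n = inverse (real (Suc n))" for n
  have h: "0 < h n" "h n \<le> 1" for n by (auto simp: h_def field_simps)
  define q where "q n z = (F (z + h n *\<^sub>R b) - F z) / h n" for n z
  have Fc: "continuous_on UNIV F"
    using F by (meson has_derivative_continuous_on has_derivative_at_withinI)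
  have F'K: "F' z b = 0" if "z \<notin> K" for z
  proof -
    have "((\<lambda>_. 0) has_derivative (\<lambda>_. 0)) (at z)" by simp
    then have "(F has_derivative (\<lambda>_. 0)) (at z)"
      by (rule has_derivative_transform_within_open[where s="- K"])
         (use that K in \<open>auto simp: open_Compl compact_imp_closed\<close>)
    then show ?thesis using has_derivative_unique[OF F] by metis
  qed
  have "\<exists>\<xi>. 0 < \<xi> \<and> \<xi> < h n \<and> q n z = F' (z + \<xi> *\<^sub>R b) b" for n z
  proof -
    have "\<exists>\<xi>. 0 < \<xi> \<and> \<xi> < h n \<and> F (z + h n *\<^sub>R b) - F (z + 0 *\<^sub>R b) = (h n - 0) * F' (z + \<xi> *\<^sub>R b) b"
    proof (rule MVT2[OF h(1)])
      fix t
      have "((\<lambda>t. z + t *\<^sub>R b) has_derivative (\<lambda>t. t *\<^sub>R b)) (at t)"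
        by (auto intro!: derivative_eq_intros)
      from has_derivative_compose[OF this F]
      have "((\<lambda>t. F (z + t *\<^sub>R b)) has_derivative (\<lambda>s. F' (z + t *\<^sub>R b) (s *\<^sub>R b))) (at t)" .
      moreover have "F' (z + t *\<^sub>R b) (s *\<^sub>R b) = F' (z + t *\<^sub>R b) b * s" for s
        using linear_scale[OF has_derivative_linear[OF F]] by simp
      ultimately show "((\<lambda>t. F (z + t *\<^sub>R b)) has_real_derivative F' (z + t *\<^sub>R b) b) (at t)"
        by (simp add: has_field_derivative_def)
    qed
    with h(1)[of n] show ?thesis by (auto simp: q_def)
  qed
  then obtain \<xi> where \<xi>: "\<And>n z. 0 < \<xi> n z" "\<And>n z. \<xi> n z < h n" "\<And>n z. q n z = F' (z + \<xi> n z *\<^sub>R b) b"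
    by metis
  define K' where "K' = (\<lambda>(s, z). z - s *\<^sub>R b) ` ({0..1} \<times> K)"
  have K': "compact K'"
    unfolding K'_def
    by (intro compact_continuous_image compact_Times K(1) compact_Icc)
       (auto simp: case_prod_unfold intro!: continuous_intros)
  have qK': "q n z = 0" if "z \<notin> K'" for n z
  proof -
    have "z + s *\<^sub>R b \<notin> K" if "0 \<le> s" "s \<le> 1" for s
    proof
      assume "z + s *\<^sub>R b \<in> K"
      then have "(z + s *\<^sub>R b) - s *\<^sub>R b \<in> K'" unfolding K'_def using that by force
      with \<open>z \<notin> K'\<close> show False by simp
    qed
    with \<xi>[of n z] h(2)[of n] show ?thesis by (auto simp: F'K)
  qed
  obtain A where A: "\<And>z. z \<in> K' \<Longrightarrow> \<bar>a z\<bar> \<le> A"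
    using compact_imp_bounded[OF compact_continuous_image[OF continuous_on_subset[OF a(1) subset_UNIV] K']]
    by (auto simp: bounded_iff)
  obtain B' where B': "\<And>z. z \<in> K \<Longrightarrow> \<bar>F' z b\<bar> \<le> B'"
    using compact_imp_bounded[OF compact_continuous_image[OF continuous_on_subset[OF F' subset_UNIV] K(1)]]
    by (auto simp: bounded_iff)
  define B where "B = max B' 0"
  have B: "\<bar>F' z b\<bar> \<le> B" for z
    using B'[of z] F'K[of z] by (cases "z \<in> K") (auto simp: B_def)
  have intF: "integrable lborel (\<lambda>z. a z * F z)"
    by (rule integrable_compact_support[OF _ K(1)]) (use a Fc K in \<open>auto intro!: continuous_intros\<close>)
  have intFh: "integrable lborel (\<lambda>z. a z * F (z + h n *\<^sub>R b))" for n
  proof (rule integrable_compact_support)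
    have "continuous_on UNIV (\<lambda>z. F (z + h n *\<^sub>R b))"
      by (rule continuous_on_compose2[OF Fc]) (auto intro!: continuous_intros)
    then show "continuous_on UNIV (\<lambda>z. a z * F (z + h n *\<^sub>R b))"
      using a(1) by (intro continuous_intros)
    show "compact ((\<lambda>z. z - h n *\<^sub>R b) ` K)"
      by (intro compact_continuous_image K(1) continuous_intros)
    show "a z * F (z + h n *\<^sub>R b) = 0" if "z \<notin> (\<lambda>z. z - h n *\<^sub>R b) ` K" for z
    proof -
      have "z + h n *\<^sub>R b \<notin> K"
      proof
        assume "z + h n *\<^sub>R b \<in> K"
        then have "(z + h n *\<^sub>R b) - h n *\<^sub>R b \<in> (\<lambda>z. z - h n *\<^sub>R b) ` K" by blast
        with that show False by simp
      qed
      then show ?thesis by (simp add: K(2))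
    qed
  qed
  have q0: "integral\<^sup>L lborel (\<lambda>z. a z * q n z) = 0" for n
  proof -
    have "integral\<^sup>L lborel (\<lambda>z. a z * F (z + h n *\<^sub>R b)) = integral\<^sup>L lborel (\<lambda>z. a z * F z)"
      using integral_lborel_translate[of "\<lambda>z. a z * F z" "h n *\<^sub>R b"] borel_measurable_integrable[OF intF] a(2)
      by simp
    moreover have "integral\<^sup>L lborel (\<lambda>z. a z * q n z) =
        (integral\<^sup>L lborel (\<lambda>z. a z * F (z + h n *\<^sub>R b)) - integral\<^sup>L lborel (\<lambda>z. a z * F z)) / h n"
      using intF intFh[of n] by (simp add: q_def right_diff_distrib flip: Bochner_Integration.integral_diff)
    ultimately show ?thesis by simp
  qed
  have "(\<lambda>n. integral\<^sup>L lborel (\<lambda>z. a z * q n z)) \<longlonglongrightarrow> integral\<^sup>L lborel (\<lambda>z. a z * F' z b)"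
  proof (rule integral_dominated_convergence)
    show "(\<lambda>z. a z * F' z b) \<in> borel_measurable lborel"
      using a(1) F' by (auto intro!: borel_measurable_continuous_onI continuous_intros)
    show "(\<lambda>z. a z * q n z) \<in> borel_measurable lborel" for n
      using borel_measurable_integrable[OF intF] borel_measurable_integrable[OF intFh[of n]]
      by (simp add: q_def right_diff_distrib)
    show "integrable lborel (\<lambda>z. indicator K' z *\<^sub>R (A * B))"
      using K' by (intro borel_integrable_compact continuous_on_const)
    show "AE z in lborel. norm (a z * q n z) \<le> indicator K' z *\<^sub>R (A * B)" for n
    proof (rule AE_I2)
      fix z
      show "norm (a z * q n z) \<le> indicator K' z *\<^sub>R (A * B)"
      proof (cases "z \<in> K'")
        case True
        have "\<bar>a z\<bar> * \<bar>q n z\<bar> \<le> A * B"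
          using A[OF True] B[of "z + \<xi> n z *\<^sub>R b"] abs_ge_zero[of "a z"]
          unfolding \<xi>(3) by (intro mult_mono) linarith+
        with True show ?thesis by (simp add: abs_mult)
      qed (simp add: qK')
    qed
    show "AE z in lborel. (\<lambda>n. a z * q n z) \<longlonglongrightarrow> a z * F' z b"
    proof (intro AE_I2 tendsto_mult tendsto_const)
      fix z
      have "h \<longlonglongrightarrow> 0" unfolding h_def by (rule LIMSEQ_inverse_real_of_nat)
      then have "(\<lambda>n. \<xi> n z) \<longlonglongrightarrow> 0"
        by (rule tendsto_sandwich[OF _ _ tendsto_const, rotated -1]) (simp_all add: \<xi> less_imp_le)
      then have "(\<lambda>n. z + \<xi> n z *\<^sub>R b) \<longlonglongrightarrow> z + 0 *\<^sub>R b"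
        by (intro tendsto_intros)
      then have "(\<lambda>n. F' (z + \<xi> n z *\<^sub>R b) b) \<longlonglongrightarrow> F' (z + 0 *\<^sub>R b) b"
        using continuous_on_tendsto_compose[OF F'] by fastforce
      then show "(\<lambda>n. q n z) \<longlonglongrightarrow> F' z b" by (simp add: \<xi>(3))
    qed
  qed
  then show ?thesis by (simp add: q0 LIMSEQ_const_iff)
qed

lemma test_function_has_weak_derivative:
  assumes \<Omega>: "open \<Omega>" and \<phi>: "\<phi> \<in> test_functions \<Omega>"
    and a: "continuous_on UNIV a" "\<And>z t. a (z + t *\<^sub>R b) = a z"
  shows "has_weak_derivative_along \<phi> a b (\<lambda>z. a z * frechet_derivative \<phi> (at z) b) \<Omega>"
  unfolding has_weak_derivative_along_def
proof (intro conjI ballI)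
  have \<Omega>s: "\<Omega> \<in> sets lebesgue" using \<Omega> by auto
  note \<phi>c = test_function_continuous[OF \<phi>, of UNIV]
    and \<phi>'c = test_function_derivative_continuous[OF \<phi>, of UNIV]
  show loc: "locally_integrable_on \<phi> \<Omega>"
    "locally_integrable_on (\<lambda>z. a z * frechet_derivative \<phi> (at z) b) \<Omega>"
    by (intro locally_integrable_on_continuous \<phi>c continuous_on_mult a(1) \<phi>'c)+
  fix \<psi> assume \<psi>: "\<psi> \<in> test_functions \<Omega>"
  note \<psi>c = test_function_continuous[OF \<psi>, of UNIV]
    and \<psi>'c = test_function_derivative_continuous[OF \<psi>, of UNIV]
  let ?D = "\<lambda>\<phi> z. frechet_derivative \<phi> (at z) b"
  obtain K where K: "compact K" "K \<subseteq> \<Omega>" "\<And>z. z \<notin> K \<Longrightarrow> \<psi> z = 0" "\<And>z v. z \<notin> K \<Longrightarrow> frechet_derivative \<psi> (at z) v = 0"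
    using test_function_support[OF \<psi>] by blast
  have i1: "integrable (lebesgue_on \<Omega>) (\<lambda>z. \<phi> z * (a z * ?D \<psi> z))"
    by (rule integrable_locally_times_continuous[OF loc(1) \<Omega>s K(1,2)])
       (auto simp: K(4) intro!: continuous_on_mult a(1) \<psi>'c)
  have i2: "integrable (lebesgue_on \<Omega>) (\<lambda>z. (a z * ?D \<phi> z) * \<psi> z)"
    by (rule integrable_locally_times_continuous[OF loc(2) \<Omega>s K(1,2)]) (auto simp: K(3) \<psi>c)
  define F' where "F' z v = \<phi> z * frechet_derivative \<psi> (at z) v + frechet_derivative \<phi> (at z) v * \<psi> z" for z v
  have "integral\<^sup>L lborel (\<lambda>z. a z * F' z b) = 0"
  proof (rule integral_directional_derivative_eq_0[where F="\<lambda>z. \<phi> z * \<psi> z", OF _ _ K(1) _ a])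
    show "((\<lambda>z. \<phi> z * \<psi> z) has_derivative F' z) (at z)" for z
      unfolding F'_def using \<phi> \<psi> by (intro has_derivative_mult test_function_has_derivative)
    show "continuous_on UNIV (\<lambda>z. F' z b)"
      unfolding F'_def by (intro continuous_intros \<phi>c \<psi>c \<phi>'c \<psi>'c)
  qed (simp add: K(3))
  moreover have "integral\<^sup>L (lebesgue_on \<Omega>) (\<lambda>z. a z * F' z b) = integral\<^sup>L lborel (\<lambda>z. a z * F' z b)"
  proof (rule integral_lebesgue_on_eq_lborel[OF _ \<Omega>s])
    show "(\<lambda>z. a z * F' z b) \<in> borel_measurable borel"
      unfolding F'_def by (intro borel_measurable_continuous_onI continuous_intros \<phi>c \<psi>c \<phi>'c \<psi>'c a(1))
    show "a z * F' z b = 0" if "z \<notin> \<Omega>" for z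
    proof -
      have "z \<notin> K" using that K(2) by blast
      then show ?thesis by (simp add: F'_def K(3,4))
    qed
  qed
  moreover have "integral\<^sup>L (lebesgue_on \<Omega>) (\<lambda>z. a z * F' z b) =
      integral\<^sup>L (lebesgue_on \<Omega>) (\<lambda>z. \<phi> z * (a z * ?D \<psi> z)) +
      integral\<^sup>L (lebesgue_on \<Omega>) (\<lambda>z. (a z * ?D \<phi> z) * \<psi> z)"
    unfolding F'_def using i1 i2 by (simp add: algebra_simps flip: Bochner_Integration.integral_add)
  ultimately show "integral\<^sup>L (lebesgue_on \<Omega>) (\<lambda>z. \<phi> z * (a z * ?D \<psi> z)) =
      - integral\<^sup>L (lebesgue_on \<Omega>) (\<lambda>z. (a z * ?D \<phi> z) * \<psi> z)"
    by simp
qed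

section \<open>Inequalities for powers of norms\<close>

text \<open>
  A substitute for Young's inequality, proved by distinguishing \<open>d \<le> \<epsilon> * s\<close> and \<open>\<epsilon> * s < d\<close>.
\<close>

lemma powr_minus_one_mult_le:
  fixes s d p \<epsilon> :: real
  assumes "1 < p" "0 \<le> s" "0 \<le> d" "0 < \<epsilon>"
  shows "s powr (p - 1) * d \<le> \<epsilon> * s powr p + \<epsilon> powr (1 - p) * d powr p"
proof (cases "d \<le> \<epsilon> * s")
  case True
  have "s powr (p - 1) * d \<le> s powr (p - 1) * (\<epsilon> * s)"
    using True by (intro mult_left_mono) auto
  also have "\<dots> = \<epsilon> * s powr p"
    using assms by (cases "s = 0") (auto simp: powr_diff)
  finally show ?thesis by (smt (verit) mult_nonneg_nonneg powr_ge_zero)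
next
  case False
  then have "0 < d" using mult_nonneg_nonneg[of \<epsilon> s] assms by linarith
  with False have d: "s \<le> d / \<epsilon>" "0 < d" using assms by (auto simp: field_simps)
  have "s powr (p - 1) * d \<le> (d / \<epsilon>) powr (p - 1) * d"
    using d assms by (intro mult_right_mono powr_mono2) auto
  also have "\<dots> = \<epsilon> powr (1 - p) * d powr p"
    using d assms by (simp add: powr_divide powr_diff field_simps)
  finally show ?thesis using assms by (smt (verit) mult_nonneg_nonneg powr_ge_zero)
qed

text \<open>Young's inequality with a small factor on either term; the constants are not optimal.\<close>

lemma mult_le_powr_conjugate:
  fixes s t p q \<epsilon> :: real
  assumes "1 < p" "q = p / (p - 1)" "0 \<le> s" "0 \<le> t" "0 < \<epsilon>"
  shows "s * t \<le> \<epsilon> * t powr p + \<epsilon> powr (1 - q) * s powr q"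
    and "s * t \<le> \<epsilon> * s powr q + \<epsilon> powr (1 - p) * t powr p"
proof -
  have q: "1 < q" "(p - 1) * q = p" "(q - 1) * p = q" "(p - 1) * (q - 1) = 1"
    using assms(1) by (auto simp: assms(2) field_simps)
  have eq: "(t powr (p - 1)) powr (q - 1) = t" "(t powr (p - 1)) powr q = t powr p"
     "(s powr (q - 1)) powr (p - 1) = s" "(s powr (q - 1)) powr p = s powr q"
    using q assms(3,4) by (simp_all add: powr_powr mult.commute)
  show "s * t \<le> \<epsilon> * t powr p + \<epsilon> powr (1 - q) * s powr q"
    using powr_minus_one_mult_le[of q "t powr (p - 1)" s \<epsilon>] q(1) assms(3-) by (simp add: eq mult.commute)
  show "s * t \<le> \<epsilon> * s powr q + \<epsilon> powr (1 - p) * t powr p"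
    using powr_minus_one_mult_le[of p "s powr (q - 1)" t \<epsilon>] assms(1,3-) by (simp add: eq)
qed

lemma powr_add_le:
  fixes s t p :: real
  assumes "0 \<le> p" "0 \<le> s" "0 \<le> t"
  shows "(s + t) powr p \<le> 2 powr p * (s powr p + t powr p)"
proof -
  have "(s + t) powr p \<le> (2 * max s t) powr p"
    using assms by (intro powr_mono2) auto
  also have "\<dots> = 2 powr p * max s t powr p"
    using assms by (simp add: powr_mult)
  also have "\<dots> \<le> 2 powr p * (s powr p + t powr p)"
    by (intro mult_left_mono) (auto simp: max_def)
  finally show ?thesis .
qed

lemma norm_add_powr_le:
  fixes a b :: "'a::real_normed_vector"
  assumes "0 \<le> p"
  shows "norm (a + b) powr p \<le> 2 powr p * (norm a powr p + norm b powr p)"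
    and "norm (a - b) powr p \<le> 2 powr p * (norm a powr p + norm b powr p)"
proof -
  have "norm c powr p \<le> 2 powr p * (norm a powr p + norm b powr p)" if "norm c \<le> norm a + norm b" for c :: 'a
  proof -
    have "norm c powr p \<le> (norm a + norm b) powr p"
      using that assms by (intro powr_mono2) auto
    also have "\<dots> \<le> 2 powr p * (norm a powr p + norm b powr p)"
      using assms by (intro powr_add_le) auto
    finally show ?thesis .
  qed
  then show "norm (a + b) powr p \<le> 2 powr p * (norm a powr p + norm b powr p)"
    and "norm (a - b) powr p \<le> 2 powr p * (norm a powr p + norm b powr p)"
    using norm_triangle_ineq norm_triangle_ineq4 by blast+
qed

text \<open>
  If the two norms differ, this is strict convexity of the power on the half-line; if they agree, it
  is strict convexity of the Euclidean norm.
\<close>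

lemma norm_powr_strict_convex:
  fixes a b :: "'a::real_inner"
  assumes p: "1 < p" and ab: "a \<noteq> b"
  shows "norm ((1/2) *\<^sub>R (a + b)) powr p < (norm a powr p + norm b powr p) / 2"
proof -
  have strict: "((s + t) / 2) powr p < (s powr p + t powr p) / 2" if st: "0 \<le> s" "s < t" for s t :: real
  proof -
    define m where "m = (s + t) / 2"
    have m: "s < m" "m < t" "m - s = (t - s) / 2" "t - m = (t - s) / 2"
      using st by (auto simp: m_def field_simps)
    have cont: "continuous_on {c..d} (\<lambda>x. x powr p)" if "0 \<le> c" for c d :: real
      using p by (intro continuous_on_powr' continuous_intros) (use that in auto)
    have der: "\<exists>\<xi>. c < \<xi> \<and> \<xi> < d \<and> d powr p - c powr p = (d - c) * (p * \<xi> powr (p - 1))"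
      if "0 \<le> c" "c < d" for c d :: real
    proof -
      have "\<exists>\<xi>>c. \<xi> < d \<and> d powr p - c powr p = (\<lambda>h. h * (p * \<xi> powr (p - 1))) (d - c)"
      proof (rule mvt[OF that(2) cont[OF that(1)]])
        fix x assume "c < x" "x < d"
        then have "((\<lambda>x. x powr p) has_real_derivative p * x powr (p - 1)) (at x)"
          using that by (intro has_real_derivative_powr) auto
        then show "((\<lambda>x. x powr p) has_derivative (\<lambda>h. h * (p * x powr (p - 1)))) (at x)"
          by (simp add: has_field_derivative_def mult.commute[of _ "p * x powr (p - 1)"])
      qed blast
      then show ?thesis by blast
    qed
    obtain \<xi> where \<xi>: "s < \<xi>" "\<xi> < m" "m powr p - s powr p = (m - s) * (p * \<xi> powr (p - 1))"
      using der[of s m] st m by auto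
    obtain \<eta> where \<eta>: "m < \<eta>" "\<eta> < t" "t powr p - m powr p = (t - m) * (p * \<eta> powr (p - 1))"
      using der[of m t] st m by auto
    have "\<xi> powr (p - 1) < \<eta> powr (p - 1)"
      using \<xi> \<eta> st m p by (intro powr_less_mono2) auto
    then have "(t - s) / 2 * (p * \<xi> powr (p - 1)) < (t - s) / 2 * (p * \<eta> powr (p - 1))"
      using st p by (intro mult_strict_left_mono) auto
    then have "m powr p - s powr p < t powr p - m powr p"
      unfolding \<xi>(3) \<eta>(3) m(3,4) .
    then have "2 * m powr p < s powr p + t powr p" by simp
    then show ?thesis unfolding m_def[symmetric] by simp
  qed
  have tri: "norm ((1/2) *\<^sub>R (a + b)) \<le> (norm a + norm b) / 2"
    using norm_triangle_ineq[of a b] by simp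
  consider "norm a < norm b" | "norm b < norm a" | "norm a = norm b" by linarith
  then show ?thesis
  proof cases
    case 1
    have "norm ((1/2) *\<^sub>R (a + b)) powr p \<le> ((norm a + norm b) / 2) powr p"
      using tri p by (intro powr_mono2) auto
    with strict[OF _ 1] show ?thesis by simp
  next
    case 2
    have "norm ((1/2) *\<^sub>R (a + b)) powr p \<le> ((norm b + norm a) / 2) powr p"
      using tri p by (intro powr_mono2) auto
    with strict[OF _ 2] show ?thesis by simp
  next
    case 3
    have "(norm (a + b))\<^sup>2 + (norm (a - b))\<^sup>2 = 2 * (norm a)\<^sup>2 + 2 * (norm b)\<^sup>2"
      by (simp add: power2_norm_eq_inner inner_simps inner_commute)
    moreover have "0 < (norm (a - b))\<^sup>2" using ab by simp
    ultimately have "(norm (a + b))\<^sup>2 < (2 * norm a)\<^sup>2"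
      using 3 by (simp add: power2_eq_square)
    then have "norm (a + b) < 2 * norm a" by (rule power_less_imp_less_base) simp
    then have "norm ((1/2) *\<^sub>R (a + b)) powr p < norm a powr p"
      using p by (intro powr_less_mono2) auto
    with 3 show ?thesis by simp
  qed
qed

text \<open>
  Uniform convexity in a pointwise form. Both sides are homogeneous of degree \<open>p\<close>, so it is enough
  to consider the unit sphere of pairs; there the convexity defect is continuous and positive on
  the compact set where the inequality is not already true with \<open>C = 0\<close>.
\<close>

lemma norm_powr_uniformly_convex:
  fixes \<epsilon> p :: real
  assumes p: "1 < p" and \<epsilon>: "0 < \<epsilon>"
  obtains C where "0 \<le> C" "\<And>a b :: 'a::euclidean_space.
    norm (a - b) powr p \<le> \<epsilon> * (norm a powr p + norm b powr p) +
      C * ((norm a powr p + norm b powr p) / 2 - norm ((1/2) *\<^sub>R (a + b)) powr p)"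
proof -
  define N where "N x = norm (fst x) powr p + norm (snd x) powr p" for x :: "'a \<times> 'a"
  define D where "D x = norm (fst x - snd x) powr p" for x :: "'a \<times> 'a"
  define f where "f x = N x / 2 - norm ((1/2) *\<^sub>R (fst x + snd x)) powr p" for x :: "'a \<times> 'a"
  have cont: "continuous_on UNIV N" "continuous_on UNIV D" "continuous_on UNIV f"
    unfolding N_def D_def f_def
    using p by (auto intro!: continuous_intros continuous_on_powr')
  have f0: "0 \<le> f x" for x
    using norm_powr_strict_convex[OF p, of "fst x" "snd x"]
    by (cases "fst x = snd x") (auto simp: f_def N_def simp flip: scaleR_2)
  have N0: "0 \<le> N x" for x by (simp add: N_def)
  define S where "S = sphere 0 1 \<inter> {x. \<epsilon> * N x \<le> D x}"
  have S: "compact S"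
    unfolding S_def
    by (intro compact_Int_closed compact_sphere closed_Collect_le continuous_intros cont)
  have "\<exists>C\<ge>0. \<forall>x\<in>sphere 0 1. D x \<le> \<epsilon> * N x + C * f x"
  proof (cases "S = {}")
    case True
    then have "\<forall>x\<in>sphere 0 1. D x \<le> \<epsilon> * N x + 0 * f x"
      by (force simp: S_def)
    then show ?thesis by blast
  next
    case False
    obtain x0 where x0: "x0 \<in> S" "\<And>x. x \<in> S \<Longrightarrow> f x0 \<le> f x"
      using continuous_attains_inf[OF S False continuous_on_subset[OF cont(3)]] by auto
    obtain x1 where x1: "x1 \<in> S" "\<And>x. x \<in> S \<Longrightarrow> D x \<le> D x1"
      using continuous_attains_sup[OF S False continuous_on_subset[OF cont(2)]] by auto
    have pos: "0 < f x0"
    proof -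
      have "fst x0 \<noteq> snd x0"
      proof
        assume eq: "fst x0 = snd x0"
        then have "\<epsilon> * N x0 \<le> 0" using x0(1) by (simp add: S_def D_def)
        then have "N x0 \<le> 0" using \<epsilon> by (simp add: mult_le_0_iff)
        then have "snd x0 = 0" using eq p by (simp add: N_def)
        with eq have "x0 = 0" by (simp add: prod_eq_iff)
        with x0(1) show False by (simp add: S_def)
      qed
      from norm_powr_strict_convex[OF p this] show ?thesis by (simp add: f_def N_def)
    qed
    have D1: "0 \<le> D x1" by (simp add: D_def)
    have "D x \<le> \<epsilon> * N x + (D x1 / f x0) * f x" if "x \<in> sphere 0 1" for x
    proof (cases "x \<in> S")
      case True
      have "D x \<le> (D x1 / f x0) * f x0" using x1(2)[OF True] pos by simp
      also have "\<dots> \<le> (D x1 / f x0) * f x"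
        using x0(2)[OF True] pos D1 by (intro mult_left_mono) auto
      finally show ?thesis using N0[of x] \<epsilon> by (smt (verit) mult_nonneg_nonneg)
    next
      case False
      then have "D x \<le> \<epsilon> * N x" using that by (auto simp: S_def)
      moreover have "0 \<le> (D x1 / f x0) * f x" using pos D1 f0 by simp
      ultimately show ?thesis by linarith
    qed
    then show ?thesis using pos D1 by (intro exI[of _ "D x1 / f x0"]) auto
  qed
  then obtain C where C: "0 \<le> C" "\<And>x. x \<in> sphere 0 1 \<Longrightarrow> D x \<le> \<epsilon> * N x + C * f x" by blast
  have "D x \<le> \<epsilon> * N x + C * f x" for x
  proof (cases "x = 0")
    case True
    then show ?thesis using p by (simp add: D_def N_def f_def)
  next
    case False
    define r where "r = norm x"
    define y where "y = (1 / r) *\<^sub>R x"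
    have r: "0 < r" and x: "x = r *\<^sub>R y" and y: "y \<in> sphere 0 1"
      using False by (auto simp: r_def y_def)
    have "D x = r powr p * D y"
      unfolding x D_def using r by (simp add: powr_mult flip: scaleR_diff_right)
    moreover have N: "N x = r powr p * N y"
      unfolding x N_def using r by (simp add: powr_mult distrib_left)
    moreover have "norm ((1/2) *\<^sub>R (fst x + snd x)) powr p = r powr p * norm ((1/2) *\<^sub>R (fst y + snd y)) powr p"
    proof -
      have "(1/2) *\<^sub>R (fst x + snd x) = r *\<^sub>R ((1/2) *\<^sub>R (fst y + snd y))"
        unfolding x by (simp add: scaleR_add_right)
      then have "norm ((1/2) *\<^sub>R (fst x + snd x)) = r * norm ((1/2) *\<^sub>R (fst y + snd y))"
        using r by (simp only: norm_scaleR abs_of_pos)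
      then show ?thesis using r by (simp only: powr_mult)
    qed
    then have "f x = r powr p * f y"
      unfolding f_def N by (simp add: right_diff_distrib)
    ultimately show ?thesis
      using mult_left_mono[OF C(2)[OF y], of "r powr p"] by (simp add: algebra_simps)
  qed
  from that[OF C(1)] this[of "(_, _)"] show ?thesis
    by (simp add: D_def N_def f_def)
qed

text \<open>
  The integrated form of this estimate is the continuity of the \<open>p\<close>-th power of the \<open>L\<^sup>p\<close> norm. Where
  \<open>a - b\<close> is small compared with \<open>b\<close>, continuity of the power at \<open>1\<close> is used; elsewhere both norms are
  bounded by a multiple of that of \<open>a - b\<close>.
\<close>

lemma norm_powr_diff_le:
  fixes \<epsilon> p :: real
  assumes p: "1 < p" and \<epsilon>: "0 < \<epsilon>"
  obtains C where "0 \<le> C" "\<And>a b :: 'a::real_normed_vector.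
    \<bar>norm a powr p - norm b powr p\<bar> \<le> \<epsilon> * norm b powr p + C * norm (a - b) powr p"
proof -
  have "((\<lambda>t::real. t powr p) \<longlongrightarrow> 1 powr p) (at 1)"
    by (intro tendsto_intros) auto
  then obtain d where d: "0 < d" "\<And>t. \<bar>t - 1\<bar> < d \<Longrightarrow> \<bar>t powr p - 1\<bar> < \<epsilon>"
    using \<epsilon> by (auto simp: LIM_eq) (metis abs_zero diff_self powr_one_eq_one)
  define C where "C = (1 + 1 / d) powr p + (1 / d) powr p"
  have "\<bar>norm a powr p - norm b powr p\<bar> \<le> \<epsilon> * norm b powr p + C * norm (a - b) powr p" for a b :: 'a
  proof (cases "norm (a - b) < d * norm b")
    case True
    then have b: "0 < norm b" using d(1) by (smt (verit) norm_ge_zero mult_nonneg_nonpos)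
    \<comment> \<open>by homogeneity, only the ratio of the norms matters\<close>
    define t where "t = norm a / norm b"
    have "\<bar>norm a - norm b\<bar> < d * norm b" using True norm_triangle_ineq3[of a b] by linarith
    then have "\<bar>t - 1\<bar> < d"
      using b by (simp add: t_def field_simps abs_less_iff)
    then have "\<bar>t powr p - 1\<bar> * norm b powr p \<le> \<epsilon> * norm b powr p"
      using d(2)[of t] by (intro mult_right_mono) auto
    moreover have "\<bar>t powr p - 1\<bar> * norm b powr p = \<bar>norm a powr p - norm b powr p\<bar>"
    proof -
      have "norm a powr p = t powr p * norm b powr p"
        using b by (simp add: t_def powr_divide)
      moreover have "\<bar>t powr p - 1\<bar> * norm b powr p = \<bar>(t powr p - 1) * norm b powr p\<bar>"
        by (simp add: abs_mult)
      ultimately show ?thesis by (simp add: left_diff_distrib)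
    qed
    moreover have "0 \<le> C * norm (a - b) powr p" by (simp add: C_def)
    ultimately show ?thesis by linarith
  next
    case False
    then have b: "norm b \<le> (1 / d) * norm (a - b)" using d(1) by (simp add: field_simps)
    then have a: "norm a \<le> (1 + 1 / d) * norm (a - b)"
      using norm_triangle_sub[of a b] by (simp add: distrib_right)
    have "norm a powr p \<le> ((1 + 1 / d) * norm (a - b)) powr p"
      using a p by (intro powr_mono2) auto
    moreover have "norm b powr p \<le> ((1 / d) * norm (a - b)) powr p"
      using b p by (intro powr_mono2) auto
    ultimately have "norm a powr p + norm b powr p \<le> C * norm (a - b) powr p"
      using d(1) unfolding C_def powr_mult[of _ "norm (a - b)"] by (simp add: powr_mult distrib_right)
    moreover have "\<bar>norm a powr p - norm b powr p\<bar> \<le> norm a powr p + norm b powr p"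
      using powr_ge_zero[of "norm a" p] powr_ge_zero[of "norm b" p] by linarith
    moreover have "0 \<le> \<epsilon> * norm b powr p" using \<epsilon> by simp
    ultimately show ?thesis by linarith
  qed
  moreover have "0 \<le> C" by (simp add: C_def)
  ultimately show ?thesis using that by blast
qed

section \<open>A Poincare inequality\<close>

text \<open>For \<open>p > 1\<close> the derivative formula also holds at \<open>0\<close>.\<close>

lemma has_real_derivative_abs_powr:
  fixes s p :: real
  assumes p: "1 < p"
  shows "((\<lambda>s. \<bar>s\<bar> powr p) has_real_derivative p * (sgn s * \<bar>s\<bar> powr (p - 1))) (at s)"
proof (cases s "0::real" rule: linorder_cases)
  case equal
  have "((\<lambda>h. \<bar>h\<bar> powr (p - 1)) \<longlongrightarrow> \<bar>0\<bar> powr (p - 1)) (at (0::real))"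
    using p by (intro tendsto_powr' tendsto_intros) auto
  then have "((\<lambda>h. \<bar>h\<bar> powr (p - 1)) \<longlongrightarrow> 0) (at (0::real))" by simp
  then have "((\<lambda>h. (\<bar>0 + h\<bar> powr p - \<bar>0\<bar> powr p) / h) \<longlongrightarrow> 0) (at (0::real))"
  proof (rule Lim_null_comparison[rotated])
    show "\<forall>\<^sub>F h in at (0::real). norm ((\<bar>0 + h\<bar> powr p - \<bar>0\<bar> powr p) / h) \<le> \<bar>h\<bar> powr (p - 1)"
      by (auto simp: eventually_at_filter powr_diff)
  qed
  with equal show ?thesis by (simp add: DERIV_def)
next
  case less
  have "((\<lambda>s. (- s) powr p) has_real_derivative p * (sgn s * \<bar>s\<bar> powr (p - 1))) (at s)"
    using less by (auto intro!: derivative_eq_intros)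
  then show ?thesis
    by (rule DERIV_cong_ev[THEN iffD1, OF refl _ refl, rotated])
       (use less in \<open>auto simp: eventually_nhds intro!: exI[of _ "{..<0}"]\<close>)
next
  case greater
  have "((\<lambda>s. s powr p) has_real_derivative p * (sgn s * \<bar>s\<bar> powr (p - 1))) (at s)"
    using greater by (auto intro!: derivative_eq_intros)
  then show ?thesis
    by (rule DERIV_cong_ev[THEN iffD1, OF refl _ refl, rotated])
       (use greater in \<open>auto simp: eventually_nhds intro!: exI[of _ "{0<..}"]\<close>)
qed

lemma continuous_on_sgn_abs_powr:
  fixes q :: real
  assumes q: "0 < q"
  shows "continuous_on UNIV (\<lambda>s::real. sgn s * \<bar>s\<bar> powr q)"
proof -
  have eq: "(\<lambda>s::real. sgn s * \<bar>s\<bar> powr q) = (\<lambda>s. max s 0 powr q - max (- s) 0 powr q)"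
    by (auto simp: fun_eq_iff sgn_if max_def)
  have "continuous_on UNIV (\<lambda>s::real. max s 0 powr q)"
    by (rule continuous_on_powr') (use q in \<open>auto intro!: continuous_intros\<close>)
  moreover have "continuous_on UNIV (\<lambda>s::real. max (- s) 0 powr q)"
    by (rule continuous_on_powr') (use q in \<open>auto intro!: continuous_intros\<close>)
  ultimately show ?thesis unfolding eq by (rule continuous_on_diff)
qed

text \<open>
  Integrating \<open>|\<phi>|\<^sup>p\<close> by parts against the derivative of the coordinate in direction \<open>b\<close> bounds it
  by the derivative of \<open>\<phi>\<close> in that one direction.
\<close>

lemma poincare_directional:
  fixes \<Omega> :: "'a::euclidean_space set"
  assumes p: "1 < p" and \<Omega>: "bounded \<Omega>" and b: "norm b = 1"
  obtains C where "0 \<le> C" "\<And>\<phi>. \<phi> \<in> test_functions \<Omega> \<Longrightarrow>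
    integral\<^sup>L lborel (\<lambda>z. \<bar>\<phi> z\<bar> powr p) \<le>
    C * integral\<^sup>L lborel (\<lambda>z. \<bar>frechet_derivative \<phi> (at z) b\<bar> powr p)"
proof -
  obtain R where R: "0 < R" "\<And>z. z \<in> \<Omega> \<Longrightarrow> norm z \<le> R"
    using \<Omega> by (auto simp: bounded_pos)
  \<comment> \<open>with this \<open>\<epsilon>\<close>, the term in \<open>\<bar>\<phi>\<bar>\<^sup>p\<close> on the right can be absorbed in the left side\<close>
  define \<epsilon> where "\<epsilon> = 1 / (2 * R * p)"
  have \<epsilon>: "0 < \<epsilon>" "R * p * \<epsilon> = 1 / 2" using R p by (auto simp: \<epsilon>_def)
  define C where "C = 2 * (R * p * \<epsilon> powr (1 - p))"
  have "integral\<^sup>L lborel (\<lambda>z. \<bar>\<phi> z\<bar> powr p) \<le>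
    C * integral\<^sup>L lborel (\<lambda>z. \<bar>frechet_derivative \<phi> (at z) b\<bar> powr p)" if \<phi>: "\<phi> \<in> test_functions \<Omega>" for \<phi>
  proof -
    note \<phi>c = test_function_continuous[OF \<phi>, of UNIV]
      and \<phi>'c = test_function_derivative_continuous[OF \<phi>, of UNIV]
    obtain K where K: "compact K" "K \<subseteq> \<Omega>" "\<And>z. z \<notin> K \<Longrightarrow> \<phi> z = 0" "\<And>z v. z \<notin> K \<Longrightarrow> frechet_derivative \<phi> (at z) v = 0"
      using test_function_support[OF \<phi>] by blast
    define P where "P s = sgn s * \<bar>s\<bar> powr (p - 1)" for s :: real
    have Pc: "continuous_on UNIV (\<lambda>z. P (\<phi> z))"
      using continuous_on_compose2[OF continuous_on_sgn_abs_powr[of "p - 1"] \<phi>c] p by (simp add: P_def)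
    have absP: "\<bar>P s\<bar> = \<bar>s\<bar> powr (p - 1)" for s
      by (auto simp: P_def abs_mult sgn_if)
    let ?D = "\<lambda>z. frechet_derivative \<phi> (at z) b"
    define F' where "F' z v = (z \<bullet> b) * (frechet_derivative \<phi> (at z) v * (p * P (\<phi> z))) + (v \<bullet> b) * \<bar>\<phi> z\<bar> powr p" for z v
    have powc: "continuous_on UNIV (\<lambda>z. \<bar>\<phi> z\<bar> powr p)"
      using p by (intro continuous_on_powr' continuous_intros \<phi>c) auto
    have Dpowc: "continuous_on UNIV (\<lambda>z. \<bar>?D z\<bar> powr p)"
      using p by (intro continuous_on_powr' continuous_intros \<phi>'c) auto
    have F'b: "F' z b = (z \<bullet> b) * (?D z * (p * P (\<phi> z))) + \<bar>\<phi> z\<bar> powr p" for z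
      using b by (simp add: F'_def norm_eq_1)
    have gc: "continuous_on UNIV (\<lambda>z. (z \<bullet> b) * (?D z * (p * P (\<phi> z))))"
      by (intro continuous_intros \<phi>'c Pc)
    have "integral\<^sup>L lborel (\<lambda>z. 1 * F' z b) = 0"
    proof (rule integral_directional_derivative_eq_0[where F="\<lambda>z. (z \<bullet> b) * \<bar>\<phi> z\<bar> powr p", OF _ _ K(1)])
      fix z
      have "((\<lambda>z. \<bar>\<phi> z\<bar> powr p) has_derivative (\<lambda>v. frechet_derivative \<phi> (at z) v * (p * P (\<phi> z)))) (at z)"
        unfolding P_def
        by (rule DERIV_compose_FDERIV[OF has_real_derivative_abs_powr[OF p] test_function_has_derivative[OF \<phi>]])
      moreover have "((\<lambda>z. z \<bullet> b) has_derivative (\<lambda>v. v \<bullet> b)) (at z)"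
        by (auto intro!: derivative_eq_intros)
      ultimately show "((\<lambda>z. (z \<bullet> b) * \<bar>\<phi> z\<bar> powr p) has_derivative F' z) (at z)"
        unfolding F'_def by (rule has_derivative_mult[rotated])
      show "continuous_on UNIV (\<lambda>z. F' z b)"
        unfolding F'b by (intro continuous_on_add gc powc)
    qed (use K(3) p in auto)
    then have zero: "integral\<^sup>L lborel (\<lambda>z. F' z b) = 0" by simp
    have ipow: "integrable lborel (\<lambda>z. \<bar>\<phi> z\<bar> powr p)"
      by (rule integrable_compact_support[OF powc K(1)]) (simp add: K(3))
    have iDpow: "integrable lborel (\<lambda>z. \<bar>?D z\<bar> powr p)"
      by (rule integrable_compact_support[OF Dpowc K(1)]) (simp add: K(4))
    have ig: "integrable lborel (\<lambda>z. (z \<bullet> b) * (?D z * (p * P (\<phi> z))))"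
      by (rule integrable_compact_support[OF gc K(1)]) (simp add: K(4))
    have "integral\<^sup>L lborel (\<lambda>z. \<bar>\<phi> z\<bar> powr p) = - integral\<^sup>L lborel (\<lambda>z. (z \<bullet> b) * (?D z * (p * P (\<phi> z))))"
      using zero ipow ig by (simp add: F'b)
    also have "\<dots> = integral\<^sup>L lborel (\<lambda>z. - ((z \<bullet> b) * (?D z * (p * P (\<phi> z)))))"
      by simp
    also have "\<dots> \<le> integral\<^sup>L lborel (\<lambda>z. 1 / 2 * \<bar>\<phi> z\<bar> powr p + C / 2 * \<bar>?D z\<bar> powr p)"
    proof (rule integral_mono)
      fix z
      show "- ((z \<bullet> b) * (?D z * (p * P (\<phi> z)))) \<le> 1 / 2 * \<bar>\<phi> z\<bar> powr p + C / 2 * \<bar>?D z\<bar> powr p"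
      proof (cases "z \<in> K")
        case True
        have "\<bar>z \<bullet> b\<bar> \<le> R"
          using Cauchy_Schwarz_ineq2[of z b] b R(2)[of z] True K(2) by auto
        then have "\<bar>z \<bullet> b\<bar> * (p * (\<bar>\<phi> z\<bar> powr (p - 1) * \<bar>?D z\<bar>)) \<le> R * (p * (\<bar>\<phi> z\<bar> powr (p - 1) * \<bar>?D z\<bar>))"
          using p by (intro mult_right_mono) auto
        also have "\<dots> \<le> R * (p * (\<epsilon> * \<bar>\<phi> z\<bar> powr p + \<epsilon> powr (1 - p) * \<bar>?D z\<bar> powr p))"
          using R p \<epsilon> by (intro mult_left_mono powr_minus_one_mult_le) auto
        also have "\<dots> = (R * p * \<epsilon>) * \<bar>\<phi> z\<bar> powr p + C / 2 * \<bar>?D z\<bar> powr p"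
          by (simp add: C_def algebra_simps)
        also have "\<dots> = 1 / 2 * \<bar>\<phi> z\<bar> powr p + C / 2 * \<bar>?D z\<bar> powr p"
          by (simp only: \<epsilon>(2))
        finally have "\<bar>(z \<bullet> b) * (?D z * (p * P (\<phi> z)))\<bar> \<le> 1 / 2 * \<bar>\<phi> z\<bar> powr p + C / 2 * \<bar>?D z\<bar> powr p"
          using p by (simp add: abs_mult absP mult_ac)
        then show ?thesis by linarith
      qed (simp add: K(3,4))
    qed (use ig ipow iDpow in auto)
    also have "\<dots> = 1 / 2 * integral\<^sup>L lborel (\<lambda>z. \<bar>\<phi> z\<bar> powr p) + C / 2 * integral\<^sup>L lborel (\<lambda>z. \<bar>?D z\<bar> powr p)"
      using ipow iDpow by simp
    finally show ?thesis by simp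
  qed
  moreover have "0 \<le> C" using R p by (simp add: C_def)
  ultimately show ?thesis using that by blast
qed

section \<open>Completeness of \<open>L\<^sup>p\<close>\<close>

lemma integrable_norm_powr_add:
  fixes f g :: "'a \<Rightarrow> 'b::{banach, second_countable_topology}"
  assumes p: "1 < p" and [measurable]: "f \<in> borel_measurable M" "g \<in> borel_measurable M"
    and "integrable M (\<lambda>x. norm (f x) powr p)" "integrable M (\<lambda>x. norm (g x) powr p)"
  shows "integrable M (\<lambda>x. norm (f x + g x) powr p)" "integrable M (\<lambda>x. norm (f x - g x) powr p)"
proof -
  have i: "integrable M (\<lambda>x. 2 powr p * (norm (f x) powr p + norm (g x) powr p))"
    using assms by simp
  show "integrable M (\<lambda>x. norm (f x + g x) powr p)"
    by (rule Bochner_Integration.integrable_bound[OF i])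
       (use norm_add_powr_le(1)[of p] p in \<open>auto intro!: AE_I2 simp: abs_mult\<close>)
  show "integrable M (\<lambda>x. norm (f x - g x) powr p)"
    by (rule Bochner_Integration.integrable_bound[OF i])
       (use norm_add_powr_le(2)[of p] p in \<open>auto intro!: AE_I2 simp: abs_mult\<close>)
qed

lemma le_eps_plus_powr:
  fixes t p \<epsilon> :: real
  assumes "1 < p" "0 \<le> t" "0 < \<epsilon>"
  shows "t \<le> \<epsilon> + \<epsilon> powr (1 - p) * t powr p"
  using powr_minus_one_mult_le[of p 1 t \<epsilon>] assms by simp

lemma (in finite_measure) integrable_of_powr:
  fixes f :: "'a \<Rightarrow> 'b::{banach, second_countable_topology}"
  assumes p: "1 < p" and f: "f \<in> borel_measurable M" "integrable M (\<lambda>x. norm (f x) powr p)"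
  shows "integrable M f"
proof (rule Bochner_Integration.integrable_bound)
  show "integrable M (\<lambda>x. 1 + norm (f x) powr p)" using f by simp
  show "AE x in M. norm (f x) \<le> norm (1 + norm (f x) powr p)"
    using le_eps_plus_powr[OF p, of "norm (f _)" 1] by (intro AE_I2) (auto intro: order_trans[OF _ abs_ge_self])
qed (use f in auto)

text \<open>
  On a finite measure space, a Cauchy sequence for the \<open>p\<close>-th power of the \<open>L\<^sup>p\<close> distance is Cauchy
  in \<open>L\<^sup>1\<close>, so a subsequence converges almost everywhere; Fatou's lemma identifies the limit.
\<close>

lemma (in finite_measure) powr_norm_complete:
  fixes f :: "nat \<Rightarrow> 'a \<Rightarrow> 'b::{banach, second_countable_topology}"
  assumes p: "1 < p"
    and f: "\<And>n. f n \<in> borel_measurable M" "\<And>n. integrable M (\<lambda>x. norm (f n x) powr p)"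
    and cauchy: "\<And>e. 0 < e \<Longrightarrow> \<exists>N. \<forall>m\<ge>N. \<forall>n\<ge>N. integral\<^sup>L M (\<lambda>x. norm (f m x - f n x) powr p) < e"
  obtains u where "u \<in> borel_measurable M" "integrable M (\<lambda>x. norm (u x) powr p)"
    "\<And>n. integrable M (\<lambda>x. norm (f n x - u x) powr p)"
    "(\<lambda>n. integral\<^sup>L M (\<lambda>x. norm (f n x - u x) powr p)) \<longlonglongrightarrow> 0"
proof -
  note [measurable] = f(1)
  note diff = integrable_norm_powr_add(2)[OF p]
  have ip: "integrable M (\<lambda>x. norm (f m x - f n x) powr p)" for m n
    by (intro diff f)
  have i1: "integrable M (f n)" for n
    by (rule integrable_of_powr[OF p f])
  have L1: "\<exists>N. \<forall>m\<ge>N. \<forall>n\<ge>N. integral\<^sup>L M (\<lambda>x. norm (f m x - f n x)) < e" if e: "0 < e" for e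
  proof -
    define \<epsilon> where "\<epsilon> = e / (2 * (1 + measure M (space M)))"
    have \<epsilon>: "0 < \<epsilon>" "\<epsilon> * measure M (space M) \<le> e / 2"
      using e by (auto simp: \<epsilon>_def field_simps add_pos_nonneg)
    obtain N where N: "\<And>m n. N \<le> m \<Longrightarrow> N \<le> n \<Longrightarrow>
        integral\<^sup>L M (\<lambda>x. norm (f m x - f n x) powr p) < e / 2 / \<epsilon> powr (1 - p)"
      using cauchy[of "e / 2 / \<epsilon> powr (1 - p)"] e \<epsilon>(1) by auto
    show ?thesis
    proof (intro exI allI impI)
      fix m n assume mn: "N \<le> m" "N \<le> n"
      have "integral\<^sup>L M (\<lambda>x. norm (f m x - f n x)) \<le>
          integral\<^sup>L M (\<lambda>x. \<epsilon> + \<epsilon> powr (1 - p) * norm (f m x - f n x) powr p)"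
        using ip i1 \<epsilon>(1) p by (intro integral_mono le_eps_plus_powr) auto
      also have "\<dots> = \<epsilon> * measure M (space M) + \<epsilon> powr (1 - p) * integral\<^sup>L M (\<lambda>x. norm (f m x - f n x) powr p)"
        using ip by (simp add: mult.commute)
      also have "\<dots> < e"
        using \<epsilon> N[OF mn] by (simp add: field_simps)
      finally show "integral\<^sup>L M (\<lambda>x. norm (f m x - f n x)) < e" .
    qed
  qed
  obtain r where r: "strict_mono r" "AE x in M. Cauchy (\<lambda>i. f (r i) x)"
    using cauchy_L1_AE_cauchy_subseq[of M f, OF i1 L1] by blast
  define u where "u x = lim (\<lambda>i. f (r i) x)" for x
  have um[measurable]: "u \<in> borel_measurable M"
    unfolding u_def by (intro borel_measurable_lim_metric) measurable
  have lim: "AE x in M. (\<lambda>i. f (r i) x) \<longlonglongrightarrow> u x"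
    using r(2) by eventually_elim (simp add: u_def Cauchy_convergent_iff convergent_LIMSEQ_iff)
  have fatou: "integrable M (\<lambda>x. norm (f n x - u x) powr p) \<and>
      integral\<^sup>L M (\<lambda>x. norm (f n x - u x) powr p) \<le> e"
    if e: "0 \<le> e" and N: "\<And>m. N \<le> m \<Longrightarrow> integral\<^sup>L M (\<lambda>x. norm (f n x - f m x) powr p) \<le> e" for n N e
  proof -
    have "(\<integral>\<^sup>+ x. ennreal (norm (f n x - u x) powr p) \<partial>M) =
        (\<integral>\<^sup>+ x. liminf (\<lambda>i. ennreal (norm (f n x - f (r i) x) powr p)) \<partial>M)"
    proof (rule nn_integral_cong_AE, use lim in eventually_elim)
      fix x assume "(\<lambda>i. f (r i) x) \<longlonglongrightarrow> u x"
      then have "(\<lambda>i. norm (f n x - f (r i) x) powr p) \<longlonglongrightarrow> norm (f n x - u x) powr p"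
        using p by (intro tendsto_powr' tendsto_intros) auto
      then have "(\<lambda>i. ennreal (norm (f n x - f (r i) x) powr p)) \<longlonglongrightarrow> ennreal (norm (f n x - u x) powr p)"
        by (rule tendsto_ennrealI)
      then show "ennreal (norm (f n x - u x) powr p) = liminf (\<lambda>i. ennreal (norm (f n x - f (r i) x) powr p))"
        by (rule lim_imp_Liminf[OF sequentially_bot, symmetric])
    qed
    also have "\<dots> \<le> liminf (\<lambda>i. \<integral>\<^sup>+ x. ennreal (norm (f n x - f (r i) x) powr p) \<partial>M)"
      by (rule nn_integral_liminf) measurable
    also have "\<dots> \<le> ennreal e"
    proof (rule Liminf_le)
      show "\<forall>\<^sub>F i in sequentially. (\<integral>\<^sup>+ x. ennreal (norm (f n x - f (r i) x) powr p) \<partial>M) \<le> ennreal e"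
        using eventually_ge_at_top[of N]
      proof eventually_elim
        fix i assume "N \<le> i"
        then have "N \<le> r i" using seq_suble[OF r(1), of i] by simp
        then show "(\<integral>\<^sup>+ x. ennreal (norm (f n x - f (r i) x) powr p) \<partial>M) \<le> ennreal e"
          using N by (subst nn_integral_eq_integral[OF ip]) (auto intro: ennreal_leI)
      qed
    qed simp
    finally have le: "(\<integral>\<^sup>+ x. ennreal (norm (f n x - u x) powr p) \<partial>M) \<le> ennreal e" .
    have int: "integrable M (\<lambda>x. norm (f n x - u x) powr p)"
      using le by (intro integrableI_bounded) (auto simp: top.not_eq_extremum[symmetric] top_unique intro: le_less_trans)
    then have "ennreal (integral\<^sup>L M (\<lambda>x. norm (f n x - u x) powr p)) \<le> ennreal e"
      using le by (subst (asm) nn_integral_eq_integral) auto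
    with e int show ?thesis by simp
  qed
  have intu: "integrable M (\<lambda>x. norm (u x) powr p)"
  proof -
    obtain N where N: "\<And>m n. N \<le> m \<Longrightarrow> N \<le> n \<Longrightarrow> integral\<^sup>L M (\<lambda>x. norm (f m x - f n x) powr p) < 1"
      using cauchy[of 1] by auto
    have "integrable M (\<lambda>x. norm (f N x - u x) powr p)"
      using fatou[of 1 N N] N by (auto intro: less_imp_le)
    from diff[OF f(1)[of N] _ f(2)[of N] this] have "integrable M (\<lambda>x. norm (f N x - (f N x - u x)) powr p)"
      by simp
    then show ?thesis by simp
  qed
  have intd: "integrable M (\<lambda>x. norm (f n x - u x) powr p)" for n
    by (intro diff f intu um)
  have "(\<lambda>n. integral\<^sup>L M (\<lambda>x. norm (f n x - u x) powr p)) \<longlonglongrightarrow> 0"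
  proof (rule LIMSEQ_I)
    fix e :: real assume e: "0 < e"
    obtain N where N: "\<And>m n. N \<le> m \<Longrightarrow> N \<le> n \<Longrightarrow> integral\<^sup>L M (\<lambda>x. norm (f m x - f n x) powr p) < e / 2"
      using cauchy[of "e / 2"] e by auto
    have "norm (integral\<^sup>L M (\<lambda>x. norm (f n x - u x) powr p) - 0) < e" if "N \<le> n" for n
    proof -
      have "integral\<^sup>L M (\<lambda>x. norm (f n x - u x) powr p) \<le> e / 2"
        using fatou[of "e / 2" N n] N[OF that] e by (auto intro: less_imp_le)
      then show ?thesis using e by (simp add: integral_nonneg_AE)
    qed
    then show "\<exists>N. \<forall>n\<ge>N. norm (integral\<^sup>L M (\<lambda>x. norm (f n x - u x) powr p) - 0) < e" by blast
  qed
  with that[OF um intu intd] show ?thesis .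
qed

section \<open>Convergence in \<open>L\<^sup>p\<close>\<close>

text \<open>
  Used for integrals whose error is at most \<open>\<epsilon>\<close> times a fixed quantity plus a
  constant depending on \<open>\<epsilon>\<close> times the \<open>p\<close>-th power of the \<open>L\<^sup>p\<close> distance.
\<close>

lemma tendsto_if_eps_bound:
  fixes x y :: "nat \<Rightarrow> real"
  assumes y: "y \<longlonglongrightarrow> 0" and A: "0 \<le> A"
    and bound: "\<And>\<epsilon>. 0 < \<epsilon> \<Longrightarrow> \<exists>C\<ge>0. \<forall>n. \<bar>x n - l\<bar> \<le> \<epsilon> * A + C * y n"
  shows "x \<longlonglongrightarrow> l"
proof (rule LIMSEQ_I)
  fix e :: real assume e: "0 < e"
  define \<epsilon> where "\<epsilon> = e / (2 * (1 + A))"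
  have \<epsilon>: "0 < \<epsilon>" "\<epsilon> * A \<le> e / 2" using e A by (auto simp: \<epsilon>_def field_simps)
  obtain C where C: "0 \<le> C" "\<And>n. \<bar>x n - l\<bar> \<le> \<epsilon> * A + C * y n" using bound[OF \<epsilon>(1)] by blast
  have "(\<lambda>n. C * y n) \<longlonglongrightarrow> C * 0" by (intro tendsto_intros y)
  then have "\<forall>\<^sub>F n in sequentially. C * y n < e / 2"
    using e by (intro order_tendstoD(2)) auto
  then have "\<forall>\<^sub>F n in sequentially. norm (x n - l) < e"
  proof eventually_elim
    case (elim n)
    with C(2)[of n] \<epsilon>(2) show ?case by simp
  qed
  then show "\<exists>N. \<forall>n\<ge>N. norm (x n - l) < e" by (simp add: eventually_sequentially)
qed

lemma integral_norm_powr_tendsto: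
  fixes f :: "nat \<Rightarrow> 'a \<Rightarrow> 'b::{banach, second_countable_topology}"
  assumes p: "1 < p" and f: "\<And>n. f n \<in> borel_measurable M" "\<And>n. integrable M (\<lambda>x. norm (f n x) powr p)"
    and u: "u \<in> borel_measurable M" "integrable M (\<lambda>x. norm (u x) powr p)"
    and lim: "(\<lambda>n. integral\<^sup>L M (\<lambda>x. norm (f n x - u x) powr p)) \<longlonglongrightarrow> 0"
  shows "(\<lambda>n. integral\<^sup>L M (\<lambda>x. norm (f n x) powr p)) \<longlonglongrightarrow> integral\<^sup>L M (\<lambda>x. norm (u x) powr p)"
proof (rule tendsto_if_eps_bound[OF lim, of "integral\<^sup>L M (\<lambda>x. norm (u x) powr p)"])
  fix \<epsilon> :: real assume "0 < \<epsilon>"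
  then obtain C where C: "0 \<le> C" "\<And>a b :: 'b.
    \<bar>norm a powr p - norm b powr p\<bar> \<le> \<epsilon> * norm b powr p + C * norm (a - b) powr p"
    using norm_powr_diff_le[OF p] by metis
  have "\<bar>integral\<^sup>L M (\<lambda>x. norm (f n x) powr p) - integral\<^sup>L M (\<lambda>x. norm (u x) powr p)\<bar> \<le>
      \<epsilon> * integral\<^sup>L M (\<lambda>x. norm (u x) powr p) + C * integral\<^sup>L M (\<lambda>x. norm (f n x - u x) powr p)" for n
  proof -
    note d = integrable_norm_powr_add(2)[OF p f(1) u(1) f(2) u(2), of n]
    have "\<bar>integral\<^sup>L M (\<lambda>x. norm (f n x) powr p) - integral\<^sup>L M (\<lambda>x. norm (u x) powr p)\<bar> =
        \<bar>integral\<^sup>L M (\<lambda>x. norm (f n x) powr p - norm (u x) powr p)\<bar>"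
      using f(2) u(2) by simp
    also have "\<dots> \<le> integral\<^sup>L M (\<lambda>x. \<bar>norm (f n x) powr p - norm (u x) powr p\<bar>)"
      by (rule integral_abs_bound)
    also have "\<dots> \<le> integral\<^sup>L M (\<lambda>x. \<epsilon> * norm (u x) powr p + C * norm (f n x - u x) powr p)"
      using f(2) u(2) d C(2) by (intro integral_mono) auto
    also have "\<dots> = \<epsilon> * integral\<^sup>L M (\<lambda>x. norm (u x) powr p) + C * integral\<^sup>L M (\<lambda>x. norm (f n x - u x) powr p)"
      using u(2) d by simp
    finally show ?thesis .
  qed
  then show "\<exists>C\<ge>0. \<forall>n. \<bar>integral\<^sup>L M (\<lambda>x. norm (f n x) powr p) - integral\<^sup>L M (\<lambda>x. norm (u x) powr p)\<bar> \<le>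
      \<epsilon> * integral\<^sup>L M (\<lambda>x. norm (u x) powr p) + C * integral\<^sup>L M (\<lambda>x. norm (f n x - u x) powr p)"
    using C(1) by blast
qed simp

lemma integrable_mult_conjugate:
  fixes f g :: "'a \<Rightarrow> real"
  assumes p: "1 < p" "q = p / (p - 1)" and [measurable]: "f \<in> borel_measurable M" "g \<in> borel_measurable M"
    and "integrable M (\<lambda>x. \<bar>f x\<bar> powr p)" "integrable M (\<lambda>x. \<bar>g x\<bar> powr q)"
  shows "integrable M (\<lambda>x. g x * f x)"
proof (rule Bochner_Integration.integrable_bound)
  show "integrable M (\<lambda>x. 1 * \<bar>g x\<bar> powr q + 1 powr (1 - p) * \<bar>f x\<bar> powr p)"
    using assms by simp
  show "AE x in M. norm (g x * f x) \<le> norm (1 * \<bar>g x\<bar> powr q + 1 powr (1 - p) * \<bar>f x\<bar> powr p)"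
    using mult_le_powr_conjugate(2)[OF p, of "\<bar>g _\<bar>" "\<bar>f _\<bar>" 1] by (intro AE_I2) (simp add: abs_mult)
qed measurable

lemma integral_mult_conjugate_tendsto:
  fixes f :: "nat \<Rightarrow> 'a \<Rightarrow> real"
  assumes p: "1 < p" "q = p / (p - 1)"
    and f: "\<And>n. f n \<in> borel_measurable M" "\<And>n. integrable M (\<lambda>x. \<bar>f n x\<bar> powr p)"
    and u: "u \<in> borel_measurable M" "integrable M (\<lambda>x. \<bar>u x\<bar> powr p)"
    and g: "g \<in> borel_measurable M" "integrable M (\<lambda>x. \<bar>g x\<bar> powr q)"
    and lim: "(\<lambda>n. integral\<^sup>L M (\<lambda>x. \<bar>f n x - u x\<bar> powr p)) \<longlonglongrightarrow> 0"
  shows "(\<lambda>n. integral\<^sup>L M (\<lambda>x. g x * f n x)) \<longlonglongrightarrow> integral\<^sup>L M (\<lambda>x. g x * u x)"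
proof (rule tendsto_if_eps_bound[OF lim, of "integral\<^sup>L M (\<lambda>x. \<bar>g x\<bar> powr q)"])
  fix \<epsilon> :: real assume \<epsilon>: "0 < \<epsilon>"
  have "\<bar>integral\<^sup>L M (\<lambda>x. g x * f n x) - integral\<^sup>L M (\<lambda>x. g x * u x)\<bar> \<le>
      \<epsilon> * integral\<^sup>L M (\<lambda>x. \<bar>g x\<bar> powr q) + \<epsilon> powr (1 - p) * integral\<^sup>L M (\<lambda>x. \<bar>f n x - u x\<bar> powr p)" for n
  proof -
    have d: "integrable M (\<lambda>x. \<bar>f n x - u x\<bar> powr p)"
      using integrable_norm_powr_add(2)[OF p(1) f(1) u(1), of n] f(2) u(2) by simp
    have i: "integrable M (\<lambda>x. g x * f n x)" "integrable M (\<lambda>x. g x * u x)"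
      using integrable_mult_conjugate[OF p] f u g by blast+
    have "\<bar>integral\<^sup>L M (\<lambda>x. g x * f n x) - integral\<^sup>L M (\<lambda>x. g x * u x)\<bar> =
        \<bar>integral\<^sup>L M (\<lambda>x. g x * f n x - g x * u x)\<bar>"
      using i by simp
    also have "\<dots> \<le> integral\<^sup>L M (\<lambda>x. \<bar>g x * f n x - g x * u x\<bar>)"
      by (rule integral_abs_bound)
    also have "\<dots> \<le> integral\<^sup>L M (\<lambda>x. \<epsilon> * \<bar>g x\<bar> powr q + \<epsilon> powr (1 - p) * \<bar>f n x - u x\<bar> powr p)"
    proof (rule integral_mono)
      fix x
      show "\<bar>g x * f n x - g x * u x\<bar> \<le> \<epsilon> * \<bar>g x\<bar> powr q + \<epsilon> powr (1 - p) * \<bar>f n x - u x\<bar> powr p"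
        using mult_le_powr_conjugate(2)[OF p, of "\<bar>g x\<bar>" "\<bar>f n x - u x\<bar>" \<epsilon>] \<epsilon>
        by (simp add: abs_mult flip: right_diff_distrib)
    qed (use i d g in auto)
    also have "\<dots> = \<epsilon> * integral\<^sup>L M (\<lambda>x. \<bar>g x\<bar> powr q) + \<epsilon> powr (1 - p) * integral\<^sup>L M (\<lambda>x. \<bar>f n x - u x\<bar> powr p)"
      using g d by simp
    finally show ?thesis .
  qed
  then show "\<exists>C\<ge>0. \<forall>n. \<bar>integral\<^sup>L M (\<lambda>x. g x * f n x) - integral\<^sup>L M (\<lambda>x. g x * u x)\<bar> \<le>
      \<epsilon> * integral\<^sup>L M (\<lambda>x. \<bar>g x\<bar> powr q) + C * integral\<^sup>L M (\<lambda>x. \<bar>f n x - u x\<bar> powr p)"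
    using powr_ge_zero by blast
qed simp

lemma borel_measurable_lebesgue_on_AE:
  fixes f g :: "'a::euclidean_space \<Rightarrow> 'b::euclidean_space"
  assumes "S \<in> sets lebesgue" and f: "f \<in> borel_measurable (lebesgue_on S)"
    and ae: "AE z in lebesgue_on S. f z = g z"
  shows "g \<in> borel_measurable (lebesgue_on S)"
proof -
  have "AE z in lebesgue. (if z \<in> S then f z else 0) = (if z \<in> S then g z else 0)"
    using ae assms(1) by (simp add: AE_restrict_space_iff)
  moreover have "(\<lambda>z. if z \<in> S then f z else 0) \<in> borel_measurable lebesgue"
    using f assms(1) by (simp add: borel_measurable_if)
  ultimately have "(\<lambda>z. if z \<in> S then g z else 0) \<in> borel_measurable lebesgue"
    by (rule borel_measurable_AE[rotated])
  then show ?thesis using assms(1) by (simp add: borel_measurable_if)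
qed

section \<open>Weak derivatives\<close>

lemma locally_integrable_on_diff:
  assumes "locally_integrable_on u \<Omega>" "locally_integrable_on v \<Omega>"
  shows "locally_integrable_on (\<lambda>z. u z - v z) \<Omega>"
  using assms by (auto simp: locally_integrable_on_def)

lemma integrable_locally_times_test_function:
  assumes \<Omega>: "open \<Omega>" and w: "locally_integrable_on w \<Omega>" and \<phi>: "\<phi> \<in> test_functions \<Omega>"
  shows "integrable (lebesgue_on \<Omega>) (\<lambda>z. w z * \<phi> z)"
    and "continuous_on UNIV a \<Longrightarrow> integrable (lebesgue_on \<Omega>) (\<lambda>z. w z * (a z * frechet_derivative \<phi> (at z) v))"
proof -
  have \<Omega>s: "\<Omega> \<in> sets lebesgue" using \<Omega> by auto
  obtain K where K: "compact K" "K \<subseteq> \<Omega>" "\<And>z. z \<notin> K \<Longrightarrow> \<phi> z = 0" "\<And>z v. z \<notin> K \<Longrightarrow> frechet_derivative \<phi> (at z) v = 0"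
    using test_function_support[OF \<phi>] by blast
  show "integrable (lebesgue_on \<Omega>) (\<lambda>z. w z * \<phi> z)"
    by (rule integrable_locally_times_continuous[OF w \<Omega>s K(1,2)])
       (auto simp: K(3) test_function_continuous[OF \<phi>])
  assume a: "continuous_on UNIV a"
  show "integrable (lebesgue_on \<Omega>) (\<lambda>z. w z * (a z * frechet_derivative \<phi> (at z) v))"
    by (rule integrable_locally_times_continuous[OF w \<Omega>s K(1,2)])
       (auto simp: K(4) intro!: continuous_on_mult a test_function_derivative_continuous[OF \<phi>])
qed

lemma has_weak_derivative_along_diff:
  assumes \<Omega>: "open \<Omega>" and a: "continuous_on UNIV a"
    and u: "has_weak_derivative_along u a b w \<Omega>" and v: "has_weak_derivative_along v a b w' \<Omega>"
  shows "has_weak_derivative_along (\<lambda>z. u z - v z) a b (\<lambda>z. w z - w' z) \<Omega>"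
  unfolding has_weak_derivative_along_def
proof (intro conjI ballI)
  have loc: "locally_integrable_on u \<Omega>" "locally_integrable_on v \<Omega>"
    "locally_integrable_on w \<Omega>" "locally_integrable_on w' \<Omega>"
    using u v by (auto simp: has_weak_derivative_along_def)
  then show "locally_integrable_on (\<lambda>z. u z - v z) \<Omega>" "locally_integrable_on (\<lambda>z. w z - w' z) \<Omega>"
    by (auto intro: locally_integrable_on_diff)
  fix \<phi> assume \<phi>: "\<phi> \<in> test_functions \<Omega>"
  note i = integrable_locally_times_test_function[OF \<Omega> _ \<phi>]
  show "integral\<^sup>L (lebesgue_on \<Omega>) (\<lambda>z. (u z - v z) * (a z * frechet_derivative \<phi> (at z) b)) =
      - integral\<^sup>L (lebesgue_on \<Omega>) (\<lambda>z. (w z - w' z) * \<phi> z)"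
    using u v \<phi> i(1)[OF loc(3)] i(1)[OF loc(4)] i(2)[OF loc(1) a] i(2)[OF loc(2) a]
    by (simp add: has_weak_derivative_along_def left_diff_distrib)
qed

lemma has_weak_derivative_along_unique:
  assumes \<Omega>: "open \<Omega>"
    and w: "has_weak_derivative_along u a b w \<Omega>" and w': "has_weak_derivative_along u a b w' \<Omega>"
  shows "AE z in lebesgue_on \<Omega>. w z = w' z"
proof -
  have loc: "locally_integrable_on w \<Omega>" "locally_integrable_on w' \<Omega>"
    using w w' by (auto simp: has_weak_derivative_along_def)
  have "AE z in lebesgue_on \<Omega>. w z - w' z = 0"
  proof (rule AE_zero_if_orthogonal_to_test_functions[OF \<Omega> locally_integrable_on_diff[OF loc]])
    fix \<phi> assume \<phi>: "\<phi> \<in> test_functions \<Omega>"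
    note i = integrable_locally_times_test_function(1)[OF \<Omega> _ \<phi>]
    show "integral\<^sup>L (lebesgue_on \<Omega>) (\<lambda>z. (w z - w' z) * \<phi> z) = 0"
      using w w' \<phi> i[OF loc(1)] i[OF loc(2)]
      by (simp add: has_weak_derivative_along_def left_diff_distrib)
  qed
  then show ?thesis by simp
qed

lemma locally_integrable_on_Lp:
  assumes \<Omega>: "open \<Omega>" "bounded \<Omega>" and p: "1 < p" and u: "u \<in> Lp_space p \<Omega>"
  shows "locally_integrable_on u \<Omega>"
proof -
  interpret finite_measure "lebesgue_on \<Omega>"
    using \<Omega> by (intro finite_measure_lebesgue_on) (simp add: lmeasurable_open)
  have "integrable (lebesgue_on \<Omega>) u"
    by (rule integrable_of_powr[OF p]) (use u in \<open>auto simp: Lp_space_def\<close>)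
  then have i: "integrable lebesgue (\<lambda>z. if z \<in> \<Omega> then u z else 0)"
    using \<Omega> by (subst Lebesgue_Measure.integrable_restrict_UNIV) auto
  show ?thesis
    unfolding locally_integrable_on_def
  proof (intro allI impI)
    fix K assume K: "compact K \<and> K \<subseteq> \<Omega>"
    then have Ks: "K \<in> sets lebesgue" by (simp add: lmeasurable_compact fmeasurableD)
    have "integrable lebesgue (\<lambda>z. indicator K z *\<^sub>R (if z \<in> \<Omega> then u z else 0))"
      by (rule integrable_mult_indicator[OF Ks i])
    also have "(\<lambda>z. indicator K z *\<^sub>R (if z \<in> \<Omega> then u z else 0)) = (\<lambda>z. if z \<in> K then u z else 0)"
      using K by (auto simp: fun_eq_iff)
    finally show "integrable (lebesgue_on K) u"
      by (simp add: Lebesgue_Measure.integrable_restrict_UNIV Ks)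
  qed
qed

text \<open>Weak differentiation is a closed operation in \<open>L\<^sup>p\<close>.\<close>

lemma has_weak_derivative_along_limit:
  assumes \<Omega>: "open \<Omega>" "bounded \<Omega>" and p: "1 < p" and a: "continuous_on UNIV a"
    and f: "\<And>n. has_weak_derivative_along (f n) a b (w n) \<Omega>"
    and L: "\<And>n. f n \<in> Lp_space p \<Omega>" "\<And>n. w n \<in> Lp_space p \<Omega>" "u \<in> Lp_space p \<Omega>" "v \<in> Lp_space p \<Omega>"
    and lim: "(\<lambda>n. integral\<^sup>L (lebesgue_on \<Omega>) (\<lambda>z. \<bar>f n z - u z\<bar> powr p)) \<longlonglongrightarrow> 0"
       "(\<lambda>n. integral\<^sup>L (lebesgue_on \<Omega>) (\<lambda>z. \<bar>w n z - v z\<bar> powr p)) \<longlonglongrightarrow> 0"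
  shows "has_weak_derivative_along u a b v \<Omega>"
  unfolding has_weak_derivative_along_def
proof (intro conjI ballI)
  show "locally_integrable_on u \<Omega>" "locally_integrable_on v \<Omega>"
    using locally_integrable_on_Lp[OF \<Omega> p] L by auto
  fix \<phi> assume \<phi>: "\<phi> \<in> test_functions \<Omega>"
  let ?D = "\<lambda>z. a z * frechet_derivative \<phi> (at z) b"
  define q where "q = p / (p - 1)"
  have q: "0 < q" using p by (simp add: q_def)
  have \<Omega>s: "\<Omega> \<in> sets lebesgue" using \<Omega> by auto
  obtain K where K: "compact K" "K \<subseteq> \<Omega>" "\<And>z. z \<notin> K \<Longrightarrow> \<phi> z = 0" "\<And>z v. z \<notin> K \<Longrightarrow> frechet_derivative \<phi> (at z) v = 0"
    using test_function_support[OF \<phi>] by blast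
  have conj: "h \<in> borel_measurable (lebesgue_on \<Omega>) \<and> integrable (lebesgue_on \<Omega>) (\<lambda>z. \<bar>h z\<bar> powr q)"
    if h: "continuous_on UNIV h" "\<And>z. z \<notin> K \<Longrightarrow> h z = 0" for h
  proof
    show "h \<in> borel_measurable (lebesgue_on \<Omega>)"
      by (rule continuous_imp_measurable_on_sets_lebesgue[OF continuous_on_subset[OF h(1)] \<Omega>s]) simp
    have "integrable (lebesgue_on \<Omega>) (\<lambda>z. 1 * \<bar>h z\<bar> powr q)"
      by (rule integrable_locally_times_continuous[OF locally_integrable_on_continuous \<Omega>s K(1,2)])
         (use h q in \<open>auto intro!: continuous_intros continuous_on_powr'\<close>)
    then show "integrable (lebesgue_on \<Omega>) (\<lambda>z. \<bar>h z\<bar> powr q)" by simp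
  qed
  have D: "?D \<in> borel_measurable (lebesgue_on \<Omega>) \<and> integrable (lebesgue_on \<Omega>) (\<lambda>z. \<bar>?D z\<bar> powr q)"
    by (rule conj) (auto simp: K(4) intro!: continuous_on_mult a test_function_derivative_continuous[OF \<phi>])
  have P: "\<phi> \<in> borel_measurable (lebesgue_on \<Omega>) \<and> integrable (lebesgue_on \<Omega>) (\<lambda>z. \<bar>\<phi> z\<bar> powr q)"
    by (rule conj) (auto simp: K(3) test_function_continuous[OF \<phi>])
  have 1: "(\<lambda>n. integral\<^sup>L (lebesgue_on \<Omega>) (\<lambda>z. ?D z * f n z)) \<longlonglongrightarrow> integral\<^sup>L (lebesgue_on \<Omega>) (\<lambda>z. ?D z * u z)"
    by (rule integral_mult_conjugate_tendsto[OF p q_def]) (use L D lim in \<open>auto simp: Lp_space_def\<close>)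
  have 2: "(\<lambda>n. integral\<^sup>L (lebesgue_on \<Omega>) (\<lambda>z. \<phi> z * w n z)) \<longlonglongrightarrow> integral\<^sup>L (lebesgue_on \<Omega>) (\<lambda>z. \<phi> z * v z)"
    by (rule integral_mult_conjugate_tendsto[OF p q_def]) (use L P lim in \<open>auto simp: Lp_space_def\<close>)
  have "integral\<^sup>L (lebesgue_on \<Omega>) (\<lambda>z. ?D z * f n z) = - integral\<^sup>L (lebesgue_on \<Omega>) (\<lambda>z. \<phi> z * w n z)" for n
  proof -
    have "integral\<^sup>L (lebesgue_on \<Omega>) (\<lambda>z. f n z * ?D z) = - integral\<^sup>L (lebesgue_on \<Omega>) (\<lambda>z. w n z * \<phi> z)"
      using f[of n] \<phi> by (simp add: has_weak_derivative_along_def)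
    then show ?thesis by (simp only: mult.commute)
  qed
  then have "(\<lambda>n. integral\<^sup>L (lebesgue_on \<Omega>) (\<lambda>z. ?D z * f n z)) \<longlonglongrightarrow> - integral\<^sup>L (lebesgue_on \<Omega>) (\<lambda>z. \<phi> z * v z)"
    using tendsto_minus[OF 2] by simp
  from LIMSEQ_unique[OF 1 this]
  show "integral\<^sup>L (lebesgue_on \<Omega>) (\<lambda>z. u z * ?D z) = - integral\<^sup>L (lebesgue_on \<Omega>) (\<lambda>z. v z * \<phi> z)"
    by (simp only: mult.commute)
qed

section \<open>The Grushin gradient\<close>

lemma continuous_on_grushin_weight:
  assumes "0 \<le> \<gamma>"
  shows "continuous_on UNIV (grushin_weight \<gamma>)"
proof (cases "\<gamma> = 0")
  case True
  then have eq: "grushin_weight \<gamma> = (\<lambda>_. 1)" by (simp add: grushin_weight_def fun_eq_iff)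
  show ?thesis unfolding eq by simp
next
  case False
  then have eq: "grushin_weight \<gamma> = (\<lambda>z. norm (fst z) powr \<gamma>)" by (simp add: grushin_weight_def fun_eq_iff)
  show ?thesis unfolding eq using False assms by (auto intro!: continuous_intros continuous_on_powr')
qed

lemma grushin_weight_translate: "grushin_weight \<gamma> (z + t *\<^sub>R (0, v)) = grushin_weight \<gamma> z"
  by (simp add: grushin_weight_def)

lemma grushin_gradient_AE:
  assumes \<Omega>: "open \<Omega>" and G: "has_grushin_gradient u \<gamma> G \<Omega>"
  shows "AE z in lebesgue_on \<Omega>. grushin_gradient \<gamma> \<Omega> u z = G z"
proof -
  have S: "has_grushin_gradient u \<gamma> (grushin_gradient \<gamma> \<Omega> u) \<Omega>"
    unfolding grushin_gradient_def using G by (rule someI[where P="\<lambda>G. has_grushin_gradient u \<gamma> G \<Omega>"])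
  have "AE z in lebesgue_on \<Omega>. fst (grushin_gradient \<gamma> \<Omega> u z) $ i = fst (G z) $ i" for i
    by (rule has_weak_derivative_along_unique[OF \<Omega>]) (use G S in \<open>auto simp: has_grushin_gradient_def\<close>)
  then have 1: "AE z in lebesgue_on \<Omega>. \<forall>i. fst (grushin_gradient \<gamma> \<Omega> u z) $ i = fst (G z) $ i"
    by (simp add: AE_all_countable)
  have "AE z in lebesgue_on \<Omega>. snd (grushin_gradient \<gamma> \<Omega> u z) $ i = snd (G z) $ i" for i
    by (rule has_weak_derivative_along_unique[OF \<Omega>]) (use G S in \<open>auto simp: has_grushin_gradient_def\<close>)
  then have 2: "AE z in lebesgue_on \<Omega>. \<forall>i. snd (grushin_gradient \<gamma> \<Omega> u z) $ i = snd (G z) $ i"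
    by (simp add: AE_all_countable)
  from 1 2 show ?thesis
    by eventually_elim (simp add: prod_eq_iff vec_eq_iff)
qed

lemma has_grushin_gradient_diff:
  assumes \<Omega>: "open \<Omega>" and \<gamma>: "0 \<le> \<gamma>"
    and "has_grushin_gradient u \<gamma> G \<Omega>" "has_grushin_gradient v \<gamma> H \<Omega>"
  shows "has_grushin_gradient (\<lambda>z. u z - v z) \<gamma> (\<lambda>z. G z - H z) \<Omega>"
  using assms(3,4) unfolding has_grushin_gradient_def
  by (auto intro!: has_weak_derivative_along_diff[OF \<Omega>] continuous_on_grushin_weight[OF \<gamma>])

text \<open>
  \<open>L\<^sup>p\<close> functions with values in a Euclidean space. For real values this is \<open>Lp_space\<close>; for
  gradients and \<open>p > 1\<close> it means that all components are in \<open>Lp_space\<close>.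
\<close>

definition Lp_vector :: "real \<Rightarrow> 'a::euclidean_space set \<Rightarrow> ('a \<Rightarrow> 'b::euclidean_space) set" where
  "Lp_vector p \<Omega> = {f \<in> borel_measurable (lebesgue_on \<Omega>). integrable (lebesgue_on \<Omega>) (\<lambda>z. norm (f z) powr p)}"

lemma Lp_vector_real: "Lp_vector p \<Omega> = Lp_space p \<Omega>"
  by (simp add: Lp_vector_def Lp_space_def)

lemma Lp_vector_bounded:
  assumes "0 \<le> p" "f \<in> Lp_vector p \<Omega>" "g \<in> borel_measurable (lebesgue_on \<Omega>)" "\<And>z. norm (g z) \<le> norm (f z)"
  shows "g \<in> Lp_vector p \<Omega>"
proof -
  have [measurable]: "g \<in> borel_measurable (lebesgue_on \<Omega>)" by fact
  have "(\<lambda>z. norm (g z) powr p) \<in> borel_measurable (lebesgue_on \<Omega>)" by measurable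
  then have "integrable (lebesgue_on \<Omega>) (\<lambda>z. norm (g z) powr p)"
    by (rule Bochner_Integration.integrable_bound[of _ "\<lambda>z. norm (f z) powr p", rotated])
       (use assms in \<open>auto simp: Lp_vector_def intro!: powr_mono2\<close>)
  with assms show ?thesis by (simp add: Lp_vector_def)
qed

lemma Lp_vector_add:
  assumes "1 < p" "f \<in> Lp_vector p \<Omega>" "g \<in> Lp_vector p \<Omega>"
  shows "(\<lambda>z. f z + g z) \<in> Lp_vector p \<Omega>" "(\<lambda>z. f z - g z) \<in> Lp_vector p \<Omega>"
  using assms integrable_norm_powr_add[OF assms(1), of f "lebesgue_on \<Omega>" g] by (auto simp: Lp_vector_def)

lemma Lp_vector_scaleR: "f \<in> Lp_vector p \<Omega> \<Longrightarrow> (\<lambda>z. c *\<^sub>R f z) \<in> Lp_vector p \<Omega>"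
  by (auto simp: Lp_vector_def powr_mult)

lemma Lp_vector_if_components:
  fixes f :: "'a::euclidean_space \<Rightarrow> 'b::euclidean_space"
  assumes p: "1 < p" and f: "\<And>b. b \<in> Basis \<Longrightarrow> (\<lambda>z. f z \<bullet> b) \<in> Lp_space p \<Omega>"
  shows "f \<in> Lp_vector p \<Omega>"
proof -
  have "(\<lambda>z. \<Sum>b\<in>B. (f z \<bullet> b) *\<^sub>R b) \<in> Lp_vector p \<Omega>" if "finite B" "B \<subseteq> Basis" for B
    using that
  proof (induction B rule: finite_induct)
    case empty
    show ?case by (simp add: Lp_vector_def)
  next
    case (insert b B)
    have "(\<lambda>z. (f z \<bullet> b) *\<^sub>R b) \<in> Lp_vector p \<Omega>"
      using f[of b] insert.prems by (auto simp: Lp_space_def Lp_vector_def)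
    with insert show ?case by (auto intro: Lp_vector_add[OF p])
  qed
  from this[of Basis] show ?thesis by (simp add: euclidean_representation)
qed

lemma Lp_vector_grushin_iff:
  fixes G :: "'a::euclidean_space \<Rightarrow> (real ^ 'n) \<times> (real ^ 'l)"
  assumes p: "1 < p"
  shows "(\<forall>i. (\<lambda>z. fst (G z) $ i) \<in> Lp_space p \<Omega>) \<and> (\<forall>j. (\<lambda>z. snd (G z) $ j) \<in> Lp_space p \<Omega>) \<longleftrightarrow>
    G \<in> Lp_vector p \<Omega>"
proof
  assume "(\<forall>i. (\<lambda>z. fst (G z) $ i) \<in> Lp_space p \<Omega>) \<and> (\<forall>j. (\<lambda>z. snd (G z) $ j) \<in> Lp_space p \<Omega>)"
  then show "G \<in> Lp_vector p \<Omega>"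
    by (intro Lp_vector_if_components[OF p])
       (auto simp: Basis_prod_def Basis_vec_def inner_prod_def inner_axis)
next
  assume G: "G \<in> Lp_vector p \<Omega>"
  then have [measurable]: "G \<in> borel_measurable (lebesgue_on \<Omega>)" by (simp add: Lp_vector_def)
  have "(\<lambda>z. G z \<bullet> b) \<in> Lp_vector p \<Omega>" if "norm b = 1" for b
    by (rule Lp_vector_bounded[OF _ G]) (use p that Cauchy_Schwarz_ineq2[of "G _" b] in auto)
  from this[of "(axis _ 1, 0)"] this[of "(0, axis _ 1)"]
  show "(\<forall>i. (\<lambda>z. fst (G z) $ i) \<in> Lp_space p \<Omega>) \<and> (\<forall>j. (\<lambda>z. snd (G z) $ j) \<in> Lp_space p \<Omega>)"
    by (auto simp: Lp_vector_real inner_prod_def inner_axis norm_prod_def)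
qed

text \<open>
  The classical Grushin gradient \<open>(\<nabla>\<^sub>x \<phi>, |x|\<^sup>\<gamma> \<nabla>\<^sub>y \<phi>)\<close>, meaningful where \<open>\<phi>\<close> is differentiable.
\<close>

definition classical_gradient ::
  "real \<Rightarrow> ((real ^ 'n) \<times> (real ^ 'l) \<Rightarrow> real) \<Rightarrow> (real ^ 'n) \<times> (real ^ 'l) \<Rightarrow> (real ^ 'n) \<times> (real ^ 'l)" where
  "classical_gradient \<gamma> \<phi> z =
     (\<chi> i. frechet_derivative \<phi> (at z) (axis i 1, 0),
      \<chi> j. grushin_weight \<gamma> z * frechet_derivative \<phi> (at z) (0, axis j 1))"

lemma test_function_has_grushin_gradient:
  assumes \<Omega>: "open \<Omega>" and \<gamma>: "0 \<le> \<gamma>" and \<phi>: "\<phi> \<in> test_functions \<Omega>"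
  shows "has_grushin_gradient \<phi> \<gamma> (classical_gradient \<gamma> \<phi>) \<Omega>"
proof -
  have "has_weak_derivative_along \<phi> (\<lambda>_. 1) b (\<lambda>z. 1 * frechet_derivative \<phi> (at z) b) \<Omega>" for b
    by (rule test_function_has_weak_derivative[OF \<Omega> \<phi>]) auto
  moreover have "has_weak_derivative_along \<phi> (grushin_weight \<gamma>) (0, b)
      (\<lambda>z. grushin_weight \<gamma> z * frechet_derivative \<phi> (at z) (0, b)) \<Omega>" for b
    by (rule test_function_has_weak_derivative[OF \<Omega> \<phi> continuous_on_grushin_weight[OF \<gamma>]])
       (rule grushin_weight_translate)
  ultimately show ?thesis
    by (simp add: has_grushin_gradient_def classical_gradient_def)
qed

lemma continuous_compact_support_Lp_vector:
  fixes f :: "'a::euclidean_space \<Rightarrow> 'b::euclidean_space"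
  assumes \<Omega>: "\<Omega> \<in> sets lebesgue" and p: "0 < p" and f: "continuous_on UNIV f"
    and K: "compact K" "K \<subseteq> \<Omega>" "\<And>z. z \<notin> K \<Longrightarrow> f z = 0"
  shows "f \<in> Lp_vector p \<Omega>"
proof -
  have "integrable (lebesgue_on \<Omega>) (\<lambda>z. 1 * norm (f z) powr p)"
    by (rule integrable_locally_times_continuous[OF locally_integrable_on_continuous \<Omega> K(1,2)])
       (use f p K in \<open>auto intro!: continuous_intros continuous_on_powr'\<close>)
  moreover have "f \<in> borel_measurable (lebesgue_on \<Omega>)"
    by (rule continuous_imp_measurable_on_sets_lebesgue[OF continuous_on_subset[OF f] \<Omega>]) simp
  ultimately show ?thesis by (simp add: Lp_vector_def)
qed

lemma test_function_Lp:
  assumes \<Omega>: "open \<Omega>" and p: "1 < p" and \<gamma>: "0 \<le> \<gamma>" and \<phi>: "\<phi> \<in> test_functions \<Omega>"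
  shows "\<phi> \<in> Lp_vector p \<Omega>" "classical_gradient \<gamma> \<phi> \<in> Lp_vector p \<Omega>"
proof -
  have \<Omega>s: "\<Omega> \<in> sets lebesgue" using \<Omega> by auto
  obtain K where K: "compact K" "K \<subseteq> \<Omega>" "\<And>z. z \<notin> K \<Longrightarrow> \<phi> z = 0" "\<And>z v. z \<notin> K \<Longrightarrow> frechet_derivative \<phi> (at z) v = 0"
    using test_function_support[OF \<phi>] by blast
  show "\<phi> \<in> Lp_vector p \<Omega>"
    using p by (intro continuous_compact_support_Lp_vector[OF \<Omega>s _ test_function_continuous[OF \<phi>] K(1,2)]) (auto simp: K(3))
  have "continuous_on UNIV (classical_gradient \<gamma> \<phi>)"
    unfolding classical_gradient_def[abs_def]
    by (intro continuous_on_Pair continuous_on_vec_lambda continuous_on_mult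
        continuous_on_grushin_weight[OF \<gamma>] test_function_derivative_continuous[OF \<phi>])
  then show "classical_gradient \<gamma> \<phi> \<in> Lp_vector p \<Omega>"
    using p by (intro continuous_compact_support_Lp_vector[OF \<Omega>s _ _ K(1,2)])
      (auto simp: K(4) classical_gradient_def zero_prod_def zero_vec_def)
qed

lemma classical_gradient_linear_combination:
  assumes "\<phi> \<in> test_functions \<Omega>" and "\<psi> \<in> test_functions \<Omega>"
  shows "classical_gradient \<gamma> (\<lambda>z. a * \<phi> z + b * \<psi> z) z =
    a *\<^sub>R classical_gradient \<gamma> \<phi> z + b *\<^sub>R classical_gradient \<gamma> \<psi> z"
  by (simp add: classical_gradient_def test_function_linear_combination(2)[OF assms] vec_eq_iff algebra_simps)

section \<open>Existence of a minimizer\<close>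

lemma norm_fst_le_norm: "norm (fst x) \<le> norm x"
  by (metis norm_fst_le prod.collapse)

lemma norm_snd_le_norm: "norm (snd x) \<le> norm x"
  by (metis norm_snd_le prod.collapse)

lemma poincare_grushin:
  fixes \<Omega> :: "((real ^ 'n) \<times> (real ^ 'l)) set"
  assumes p: "1 < p" and \<gamma>: "0 \<le> \<gamma>" and \<Omega>: "open \<Omega>" "bounded \<Omega>"
  obtains C where "0 \<le> C" "\<And>\<phi>. \<phi> \<in> test_functions \<Omega> \<Longrightarrow>
    integral\<^sup>L (lebesgue_on \<Omega>) (\<lambda>z. \<bar>\<phi> z\<bar> powr p) \<le>
    C * integral\<^sup>L (lebesgue_on \<Omega>) (\<lambda>z. norm (classical_gradient \<gamma> \<phi> z) powr p)"
proof -
  define b :: "(real ^ 'n) \<times> (real ^ 'l)" where "b = (axis undefined 1, 0)"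
  have \<Omega>s: "\<Omega> \<in> sets lebesgue" using \<Omega> by auto
  have "norm b = 1" by (simp add: b_def norm_prod_def)
  then obtain C where C: "0 \<le> C" "\<And>\<phi>. \<phi> \<in> test_functions \<Omega> \<Longrightarrow>
      integral\<^sup>L lborel (\<lambda>z. \<bar>\<phi> z\<bar> powr p) \<le>
      C * integral\<^sup>L lborel (\<lambda>z. \<bar>frechet_derivative \<phi> (at z) b\<bar> powr p)"
    using poincare_directional[OF p \<Omega>(2)] by blast
  have "integral\<^sup>L (lebesgue_on \<Omega>) (\<lambda>z. \<bar>\<phi> z\<bar> powr p) \<le>
      C * integral\<^sup>L (lebesgue_on \<Omega>) (\<lambda>z. norm (classical_gradient \<gamma> \<phi> z) powr p)"
    if \<phi>: "\<phi> \<in> test_functions \<Omega>" for \<phi>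
  proof -
    let ?D = "\<lambda>z. frechet_derivative \<phi> (at z) b"
    obtain K where K: "compact K" "K \<subseteq> \<Omega>" "\<And>z. z \<notin> K \<Longrightarrow> \<phi> z = 0" "\<And>z v. z \<notin> K \<Longrightarrow> frechet_derivative \<phi> (at z) v = 0"
      using test_function_support[OF \<phi>] by blast
    have off: "\<phi> z = 0" "?D z = 0" if "z \<notin> \<Omega>" for z
      using K(2) that by (auto intro: K(3,4))
    have [measurable]: "\<phi> \<in> borel_measurable borel" "?D \<in> borel_measurable borel"
      by (rule borel_measurable_continuous_onI test_function_continuous[OF \<phi>]
          test_function_derivative_continuous[OF \<phi>])+
    have D: "?D \<in> Lp_vector p \<Omega>"
      by (rule continuous_compact_support_Lp_vector[OF \<Omega>s _ test_function_derivative_continuous[OF \<phi>] K(1,2)])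
         (use p K(4) in auto)
    have "integral\<^sup>L (lebesgue_on \<Omega>) (\<lambda>z. \<bar>\<phi> z\<bar> powr p) = integral\<^sup>L lborel (\<lambda>z. \<bar>\<phi> z\<bar> powr p)"
      by (rule integral_lebesgue_on_eq_lborel[OF _ \<Omega>s]) (auto simp: off)
    also have "\<dots> \<le> C * integral\<^sup>L lborel (\<lambda>z. \<bar>?D z\<bar> powr p)"
      by (rule C(2)[OF \<phi>])
    also have "integral\<^sup>L lborel (\<lambda>z. \<bar>?D z\<bar> powr p) = integral\<^sup>L (lebesgue_on \<Omega>) (\<lambda>z. \<bar>?D z\<bar> powr p)"
      by (rule integral_lebesgue_on_eq_lborel[OF _ \<Omega>s, symmetric]) (auto simp: off)
    also have "C * \<dots> \<le> C * integral\<^sup>L (lebesgue_on \<Omega>) (\<lambda>z. norm (classical_gradient \<gamma> \<phi> z) powr p)"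
    proof (intro mult_left_mono C(1) integral_mono)
      fix z
      have "\<bar>?D z\<bar> = \<bar>fst (classical_gradient \<gamma> \<phi> z) $ undefined\<bar>"
        by (simp add: classical_gradient_def b_def)
      also have "\<dots> \<le> norm (fst (classical_gradient \<gamma> \<phi> z))"
        by (rule component_le_norm_cart)
      also have "\<dots> \<le> norm (classical_gradient \<gamma> \<phi> z)"
        by (rule norm_fst_le_norm)
      finally show "\<bar>?D z\<bar> powr p \<le> norm (classical_gradient \<gamma> \<phi> z) powr p"
        using p by (intro powr_mono2) auto
    qed (use D test_function_Lp(2)[OF \<Omega>(1) p \<gamma> \<phi>] in \<open>auto simp: Lp_vector_def\<close>)
    finally show ?thesis .
  qed
  with C(1) that show ?thesis by blast
qed

text \<open>
  The choice operator in the definition of the gradient, and hence also in that of the norm and of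
  the energy, can be replaced by any weak gradient that is in \<open>L\<^sup>p\<close>.
\<close>

lemma grushin_gradient_Lp:
  assumes \<Omega>: "open \<Omega>" and G: "has_grushin_gradient u \<gamma> G \<Omega>" "G \<in> Lp_vector p \<Omega>"
  shows "grushin_gradient \<gamma> \<Omega> u \<in> borel_measurable (lebesgue_on \<Omega>)"
    and "AE z in lebesgue_on \<Omega>. norm (grushin_gradient \<gamma> \<Omega> u z) powr p = norm (G z) powr p"
proof -
  have ae: "AE z in lebesgue_on \<Omega>. grushin_gradient \<gamma> \<Omega> u z = G z"
    by (rule grushin_gradient_AE[OF \<Omega> G(1)])
  then show "AE z in lebesgue_on \<Omega>. norm (grushin_gradient \<gamma> \<Omega> u z) powr p = norm (G z) powr p"
    by eventually_elim simp
  have "AE z in lebesgue_on \<Omega>. G z = grushin_gradient \<gamma> \<Omega> u z"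
    using ae by eventually_elim simp
  then show "grushin_gradient \<gamma> \<Omega> u \<in> borel_measurable (lebesgue_on \<Omega>)"
    by (rule borel_measurable_lebesgue_on_AE[rotated 2]) (use \<Omega> G(2) in \<open>auto simp: Lp_vector_def\<close>)
qed

lemma grushin_energy_eq:
  assumes \<Omega>: "open \<Omega>" and G: "has_grushin_gradient u \<gamma> G \<Omega>" "G \<in> Lp_vector p \<Omega>"
  shows "grushin_energy p \<gamma> \<Omega> g u = 1 / p * integral\<^sup>L (lebesgue_on \<Omega>) (\<lambda>z. norm (G z) powr p) -
    integral\<^sup>L (lebesgue_on \<Omega>) (\<lambda>z. g z * u z)"
proof -
  note [measurable] = grushin_gradient_Lp(1)[OF assms]
  have [measurable]: "G \<in> borel_measurable (lebesgue_on \<Omega>)" using G by (simp add: Lp_vector_def)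
  have "integral\<^sup>L (lebesgue_on \<Omega>) (\<lambda>z. norm (grushin_gradient \<gamma> \<Omega> u z) powr p) =
      integral\<^sup>L (lebesgue_on \<Omega>) (\<lambda>z. norm (G z) powr p)"
    by (rule integral_cong_AE[OF _ _ grushin_gradient_Lp(2)[OF assms]]) measurable
  then show ?thesis by (simp add: grushin_energy_def)
qed

lemma W_norm_eq:
  assumes \<Omega>: "open \<Omega>" and G: "has_grushin_gradient u \<gamma> G \<Omega>" "G \<in> Lp_vector p \<Omega>" and u: "u \<in> Lp_vector p \<Omega>"
  shows "W_norm p \<gamma> \<Omega> u = (integral\<^sup>L (lebesgue_on \<Omega>) (\<lambda>z. norm (G z) powr p) +
    integral\<^sup>L (lebesgue_on \<Omega>) (\<lambda>z. \<bar>u z\<bar> powr p)) powr (1 / p)"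
proof -
  note [measurable] = grushin_gradient_Lp(1)[OF \<Omega> G]
  have [measurable]: "G \<in> borel_measurable (lebesgue_on \<Omega>)" "u \<in> borel_measurable (lebesgue_on \<Omega>)"
    using G u by (simp_all add: Lp_vector_def)
  have ae: "AE z in lebesgue_on \<Omega>. norm (grushin_gradient \<gamma> \<Omega> u z) powr p + \<bar>u z\<bar> powr p =
      norm (G z) powr p + \<bar>u z\<bar> powr p"
    using grushin_gradient_Lp(2)[OF \<Omega> G] by eventually_elim simp
  have "integral\<^sup>L (lebesgue_on \<Omega>) (\<lambda>z. norm (grushin_gradient \<gamma> \<Omega> u z) powr p + \<bar>u z\<bar> powr p) =
      integral\<^sup>L (lebesgue_on \<Omega>) (\<lambda>z. norm (G z) powr p + \<bar>u z\<bar> powr p)"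
    by (rule integral_cong_AE[OF _ _ ae]) measurable
  also have "\<dots> = integral\<^sup>L (lebesgue_on \<Omega>) (\<lambda>z. norm (G z) powr p) +
      integral\<^sup>L (lebesgue_on \<Omega>) (\<lambda>z. \<bar>u z\<bar> powr p)"
    using G u by (intro Bochner_Integration.integral_add) (auto simp: Lp_vector_def)
  finally show ?thesis by (simp add: W_norm_def)
qed

lemma W_space_iff:
  assumes p: "1 < p"
  shows "u \<in> W_space p \<gamma> \<Omega> \<longleftrightarrow> u \<in> Lp_vector p \<Omega> \<and> (\<exists>G \<in> Lp_vector p \<Omega>. has_grushin_gradient u \<gamma> G \<Omega>)"
  unfolding W_space_def Lp_vector_grushin_iff[OF p] Lp_vector_real by blast

text \<open>
  The test functions \<open>\<phi> n\<close> converge to \<open>u\<close> in \<open>L\<^sup>p\<close> and their classical gradients converge to \<open>G\<close> in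
  \<open>L\<^sup>p\<close>. It is not required that \<open>G\<close> is a weak gradient of \<open>u\<close>; this follows. If \<open>\<Omega>\<close> is
  bounded and open, \<open>p > 1\<close> and \<open>\<gamma> \<ge> 0\<close>, then \<open>W0_space\<close> consists of the functions \<open>u\<close> that have such
  an approximation.
\<close>

definition test_approximation ::
  "real \<Rightarrow> real \<Rightarrow> ((real ^ 'n) \<times> (real ^ 'l)) set \<Rightarrow> ((real ^ 'n) \<times> (real ^ 'l) \<Rightarrow> real) \<Rightarrow>
   ((real ^ 'n) \<times> (real ^ 'l) \<Rightarrow> (real ^ 'n) \<times> (real ^ 'l)) \<Rightarrow> (nat \<Rightarrow> (real ^ 'n) \<times> (real ^ 'l) \<Rightarrow> real) \<Rightarrow> bool" where
  "test_approximation p \<gamma> \<Omega> u G \<phi> \<longleftrightarrow>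
     u \<in> Lp_vector p \<Omega> \<and> G \<in> Lp_vector p \<Omega> \<and> (\<forall>n. \<phi> n \<in> test_functions \<Omega>) \<and>
     (\<lambda>n. integral\<^sup>L (lebesgue_on \<Omega>) (\<lambda>z. \<bar>\<phi> n z - u z\<bar> powr p)) \<longlonglongrightarrow> 0 \<and>
     (\<lambda>n. integral\<^sup>L (lebesgue_on \<Omega>) (\<lambda>z. norm (classical_gradient \<gamma> (\<phi> n) z - G z) powr p)) \<longlonglongrightarrow> 0"

lemma test_approximation_has_grushin_gradient:
  assumes \<Omega>: "open \<Omega>" "bounded \<Omega>" and p: "1 < p" and \<gamma>: "0 \<le> \<gamma>"
    and ap: "test_approximation p \<gamma> \<Omega> u G \<phi>"
  shows "has_grushin_gradient u \<gamma> G \<Omega>"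
proof -
  have u: "u \<in> Lp_space p \<Omega>" and G: "G \<in> Lp_vector p \<Omega>" and \<phi>: "\<And>n. \<phi> n \<in> test_functions \<Omega>"
    and lim: "(\<lambda>n. integral\<^sup>L (lebesgue_on \<Omega>) (\<lambda>z. \<bar>\<phi> n z - u z\<bar> powr p)) \<longlonglongrightarrow> 0"
      "(\<lambda>n. integral\<^sup>L (lebesgue_on \<Omega>) (\<lambda>z. norm (classical_gradient \<gamma> (\<phi> n) z - G z) powr p)) \<longlonglongrightarrow> 0"
    using ap by (simp_all add: test_approximation_def Lp_vector_real)
  let ?H = "\<lambda>n. classical_gradient \<gamma> (\<phi> n)"
  have H: "?H n \<in> Lp_vector p \<Omega>" "\<phi> n \<in> Lp_space p \<Omega>" "has_grushin_gradient (\<phi> n) \<gamma> (?H n) \<Omega>" for n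
    using test_function_Lp[OF \<Omega>(1) p \<gamma> \<phi>] test_function_has_grushin_gradient[OF \<Omega>(1) \<gamma> \<phi>]
    by (simp_all add: Lp_vector_real)
  have D: "(\<lambda>z. ?H n z - G z) \<in> Lp_vector p \<Omega>" for n
    by (rule Lp_vector_add[OF p H(1) G])
  have comp: "(\<lambda>n. integral\<^sup>L (lebesgue_on \<Omega>) (\<lambda>z. \<bar>h n z\<bar> powr p)) \<longlonglongrightarrow> 0"
    if h: "\<And>n. h n \<in> Lp_space p \<Omega>" and le: "\<And>n z. \<bar>h n z\<bar> \<le> norm (?H n z - G z)" for h
  proof (rule tendsto_sandwich[OF _ _ tendsto_const lim(2)])
    have "integral\<^sup>L (lebesgue_on \<Omega>) (\<lambda>z. \<bar>h n z\<bar> powr p) \<le> integral\<^sup>L (lebesgue_on \<Omega>) (\<lambda>z. norm (?H n z - G z) powr p)" for n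
      using h[of n] D[of n] p le
      by (intro integral_mono powr_mono2) (auto simp: Lp_vector_def Lp_space_def)
    then show "\<forall>\<^sub>F n in sequentially. integral\<^sup>L (lebesgue_on \<Omega>) (\<lambda>z. \<bar>h n z\<bar> powr p) \<le>
        integral\<^sup>L (lebesgue_on \<Omega>) (\<lambda>z. norm (?H n z - G z) powr p)" by simp
  qed (simp add: integral_nonneg_AE)
  note G' = G[THEN Lp_vector_grushin_iff[OF p, THEN iffD2]] and H' = H(1)[THEN Lp_vector_grushin_iff[OF p, THEN iffD2]]
    and D' = D[THEN Lp_vector_grushin_iff[OF p, THEN iffD2]]
  show ?thesis
    unfolding has_grushin_gradient_def
  proof (intro conjI allI)
    fix i
    show "has_weak_derivative_along u (\<lambda>_. 1) (axis i 1, 0) (\<lambda>z. fst (G z) $ i) \<Omega>"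
    proof (rule has_weak_derivative_along_limit[OF \<Omega> p _ _ H(2) _ u _ lim(1)])
      show "has_weak_derivative_along (\<phi> n) (\<lambda>_. 1) (axis i 1, 0) (\<lambda>z. fst (?H n z) $ i) \<Omega>" for n
        using H(3)[of n] by (simp add: has_grushin_gradient_def)
      show "(\<lambda>z. fst (?H n z) $ i) \<in> Lp_space p \<Omega>" for n using H'[of n] by blast
      show "(\<lambda>z. fst (G z) $ i) \<in> Lp_space p \<Omega>" using G' by blast
      show "(\<lambda>n. integral\<^sup>L (lebesgue_on \<Omega>) (\<lambda>z. \<bar>fst (?H n z) $ i - fst (G z) $ i\<bar> powr p)) \<longlonglongrightarrow> 0"
      proof (rule comp)
        show "(\<lambda>z. fst (?H n z) $ i - fst (G z) $ i) \<in> Lp_space p \<Omega>" for n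
          using D'[of n] by simp
        show "\<bar>fst (?H n z) $ i - fst (G z) $ i\<bar> \<le> norm (?H n z - G z)" for n z
          using component_le_norm_cart[of "fst (?H n z - G z)" i] norm_fst_le_norm[of "?H n z - G z"] by simp
      qed
    qed simp
  next
    fix j
    show "has_weak_derivative_along u (grushin_weight \<gamma>) (0, axis j 1) (\<lambda>z. snd (G z) $ j) \<Omega>"
    proof (rule has_weak_derivative_along_limit[OF \<Omega> p _ _ H(2) _ u _ lim(1)])
      show "has_weak_derivative_along (\<phi> n) (grushin_weight \<gamma>) (0, axis j 1) (\<lambda>z. snd (?H n z) $ j) \<Omega>" for n
        using H(3)[of n] by (simp add: has_grushin_gradient_def)
      show "(\<lambda>z. snd (?H n z) $ j) \<in> Lp_space p \<Omega>" for n using H'[of n] by blast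
      show "(\<lambda>z. snd (G z) $ j) \<in> Lp_space p \<Omega>" using G' by blast
      show "(\<lambda>n. integral\<^sup>L (lebesgue_on \<Omega>) (\<lambda>z. \<bar>snd (?H n z) $ j - snd (G z) $ j\<bar> powr p)) \<longlonglongrightarrow> 0"
      proof (rule comp)
        show "(\<lambda>z. snd (?H n z) $ j - snd (G z) $ j) \<in> Lp_space p \<Omega>" for n
          using D'[of n] by simp
        show "\<bar>snd (?H n z) $ j - snd (G z) $ j\<bar> \<le> norm (?H n z - G z)" for n z
          using component_le_norm_cart[of "snd (?H n z - G z)" j] norm_snd_le_norm[of "?H n z - G z"] by simp
      qed
    qed (rule continuous_on_grushin_weight[OF \<gamma>])
  qed
qed

lemma W_norm_diff_test_function:
  assumes \<Omega>: "open \<Omega>" and p: "1 < p" and \<gamma>: "0 \<le> \<gamma>"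
    and u: "u \<in> Lp_vector p \<Omega>" and G: "has_grushin_gradient u \<gamma> G \<Omega>" "G \<in> Lp_vector p \<Omega>"
    and \<phi>: "\<phi> \<in> test_functions \<Omega>"
  shows "W_norm p \<gamma> \<Omega> (\<lambda>z. u z - \<phi> z) =
    (integral\<^sup>L (lebesgue_on \<Omega>) (\<lambda>z. norm (classical_gradient \<gamma> \<phi> z - G z) powr p) +
     integral\<^sup>L (lebesgue_on \<Omega>) (\<lambda>z. \<bar>\<phi> z - u z\<bar> powr p)) powr (1 / p)"
  using W_norm_eq[OF \<Omega> has_grushin_gradient_diff[OF \<Omega> \<gamma> G(1) test_function_has_grushin_gradient[OF \<Omega> \<gamma> \<phi>]]
      Lp_vector_add(2)[OF p G(2) test_function_Lp(2)[OF \<Omega> p \<gamma> \<phi>]]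
      Lp_vector_add(2)[OF p u test_function_Lp(1)[OF \<Omega> p \<gamma> \<phi>]]]
  by (simp add: norm_minus_commute abs_minus_commute)

lemma W0_space_iff_test_approximation:
  assumes \<Omega>: "open \<Omega>" "bounded \<Omega>" and p: "1 < p" and \<gamma>: "0 \<le> \<gamma>"
  shows "u \<in> W0_space p \<gamma> \<Omega> \<longleftrightarrow> (\<exists>G \<phi>. test_approximation p \<gamma> \<Omega> u G \<phi>)"
proof
  let ?M = "lebesgue_on \<Omega>"
  assume u0: "u \<in> W0_space p \<gamma> \<Omega>"
  then obtain G where u: "u \<in> Lp_vector p \<Omega>" and G: "has_grushin_gradient u \<gamma> G \<Omega>" "G \<in> Lp_vector p \<Omega>"
    by (auto simp: W0_space_def W_space_iff[OF p])
  let ?A = "\<lambda>\<phi>. integral\<^sup>L ?M (\<lambda>z. norm (classical_gradient \<gamma> \<phi> z - G z) powr p)"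
  let ?B = "\<lambda>\<phi>. integral\<^sup>L ?M (\<lambda>z. \<bar>\<phi> z - u z\<bar> powr p)"
  have AB: "0 \<le> ?A \<phi>" "0 \<le> ?B \<phi>" for \<phi> by (simp_all add: integral_nonneg_AE)
  have "\<exists>\<phi>\<in>test_functions \<Omega>. ?A \<phi> + ?B \<phi> < inverse (real (Suc n))" for n
  proof -
    have "0 < inverse (real (Suc n)) powr (1 / p)" by simp
    then obtain \<phi> where \<phi>: "\<phi> \<in> test_functions \<Omega>" "W_norm p \<gamma> \<Omega> (\<lambda>z. u z - \<phi> z) < inverse (real (Suc n)) powr (1 / p)"
      using u0 unfolding W0_space_def by blast
    then have "(?A \<phi> + ?B \<phi>) powr (1 / p) < inverse (real (Suc n)) powr (1 / p)"
      by (simp add: W_norm_diff_test_function[OF \<Omega>(1) p \<gamma> u G])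
    then have "?A \<phi> + ?B \<phi> < inverse (real (Suc n))"
      using powr_mono2[of "1 / p" "inverse (real (Suc n))" "?A \<phi> + ?B \<phi>"] p by (force simp: not_le[symmetric])
    with \<phi>(1) show ?thesis by blast
  qed
  then have "\<forall>n. \<exists>\<phi>. \<phi> \<in> test_functions \<Omega> \<and> ?A \<phi> + ?B \<phi> < inverse (real (Suc n))"
    by blast
  from choice[OF this] obtain \<phi> where \<phi>: "\<And>n. \<phi> n \<in> test_functions \<Omega>"
      "\<And>n. ?A (\<phi> n) + ?B (\<phi> n) < inverse (real (Suc n))"
    by blast
  have sq: "x \<longlonglongrightarrow> 0" if "\<And>n. 0 \<le> x n" "\<And>n. x n \<le> inverse (real (Suc n))" for x :: "nat \<Rightarrow> real"
    using that by (intro real_tendsto_sandwich[OF _ _ tendsto_const LIMSEQ_inverse_real_of_nat]) auto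
  have le: "?A (\<phi> n) \<le> inverse (real (Suc n))" "?B (\<phi> n) \<le> inverse (real (Suc n))" for n
    using \<phi>(2)[of n] AB[of "\<phi> n"] by linarith+
  have "(\<lambda>n. ?A (\<phi> n)) \<longlonglongrightarrow> 0" "(\<lambda>n. ?B (\<phi> n)) \<longlonglongrightarrow> 0"
    by (rule sq[OF AB(1) le(1)], rule sq[OF AB(2) le(2)])
  then have "test_approximation p \<gamma> \<Omega> u G \<phi>"
    using u G(2) \<phi>(1) by (simp add: test_approximation_def)
  then show "\<exists>G \<phi>. test_approximation p \<gamma> \<Omega> u G \<phi>" by blast
next
  let ?M = "lebesgue_on \<Omega>"
  assume "\<exists>G \<phi>. test_approximation p \<gamma> \<Omega> u G \<phi>"
  then obtain G \<phi> where ap: "test_approximation p \<gamma> \<Omega> u G \<phi>" by blast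
  have u: "u \<in> Lp_vector p \<Omega>" and G: "G \<in> Lp_vector p \<Omega>" and \<phi>: "\<And>n. \<phi> n \<in> test_functions \<Omega>"
    and lim: "(\<lambda>n. integral\<^sup>L ?M (\<lambda>z. \<bar>\<phi> n z - u z\<bar> powr p)) \<longlonglongrightarrow> 0"
      "(\<lambda>n. integral\<^sup>L ?M (\<lambda>z. norm (classical_gradient \<gamma> (\<phi> n) z - G z) powr p)) \<longlonglongrightarrow> 0"
    using ap by (simp_all add: test_approximation_def)
  note Gu = test_approximation_has_grushin_gradient[OF \<Omega> p \<gamma> ap]
  have "(\<lambda>n. (integral\<^sup>L ?M (\<lambda>z. norm (classical_gradient \<gamma> (\<phi> n) z - G z) powr p) +
      integral\<^sup>L ?M (\<lambda>z. \<bar>\<phi> n z - u z\<bar> powr p)) powr (1 / p)) \<longlonglongrightarrow> (0 + 0) powr (1 / p)"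
    using p by (intro tendsto_powr' tendsto_add lim tendsto_const)
      (auto intro!: always_eventually add_nonneg_nonneg integral_nonneg_AE)
  then have "(\<lambda>n. W_norm p \<gamma> \<Omega> (\<lambda>z. u z - \<phi> n z)) \<longlonglongrightarrow> 0"
    by (simp add: W_norm_diff_test_function[OF \<Omega>(1) p \<gamma> u Gu G \<phi>])
  then have "\<exists>n. W_norm p \<gamma> \<Omega> (\<lambda>z. u z - \<phi> n z) < \<epsilon>" if "0 < \<epsilon>" for \<epsilon>
    by (rule eventually_happens'[OF sequentially_bot order_tendstoD(2)[OF _ that]])
  then have "\<exists>\<phi>\<in>test_functions \<Omega>. W_norm p \<gamma> \<Omega> (\<lambda>z. u z - \<phi> z) < \<epsilon>" if "0 < \<epsilon>" for \<epsilon>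
    using \<phi> that by blast
  then show "u \<in> W0_space p \<gamma> \<Omega>"
    using u G Gu by (auto simp: W0_space_def W_space_iff[OF p])
qed

text \<open>The energy of a test function, expressed with its classical gradient.\<close>

definition test_energy ::
  "real \<Rightarrow> real \<Rightarrow> ((real ^ 'n) \<times> (real ^ 'l)) set \<Rightarrow> ((real ^ 'n) \<times> (real ^ 'l) \<Rightarrow> real) \<Rightarrow>
   ((real ^ 'n) \<times> (real ^ 'l) \<Rightarrow> real) \<Rightarrow> real" where
  "test_energy p \<gamma> \<Omega> g \<phi> =
     1 / p * integral\<^sup>L (lebesgue_on \<Omega>) (\<lambda>z. norm (classical_gradient \<gamma> \<phi> z) powr p) -
     integral\<^sup>L (lebesgue_on \<Omega>) (\<lambda>z. g z * \<phi> z)"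

lemma test_energy_tendsto:
  assumes \<Omega>: "open \<Omega>" "bounded \<Omega>" and p: "1 < p" and \<gamma>: "0 \<le> \<gamma>"
    and g: "g \<in> Lp_space (p / (p - 1)) \<Omega>" and ap: "test_approximation p \<gamma> \<Omega> u G \<phi>"
  shows "(\<lambda>n. test_energy p \<gamma> \<Omega> g (\<phi> n)) \<longlonglongrightarrow> grushin_energy p \<gamma> \<Omega> g u"
proof -
  let ?M = "lebesgue_on \<Omega>"
  have u: "u \<in> Lp_vector p \<Omega>" and G: "G \<in> Lp_vector p \<Omega>" and \<phi>: "\<And>n. \<phi> n \<in> test_functions \<Omega>"
    and lim: "(\<lambda>n. integral\<^sup>L ?M (\<lambda>z. \<bar>\<phi> n z - u z\<bar> powr p)) \<longlonglongrightarrow> 0"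
      "(\<lambda>n. integral\<^sup>L ?M (\<lambda>z. norm (classical_gradient \<gamma> (\<phi> n) z - G z) powr p)) \<longlonglongrightarrow> 0"
    using ap by (simp_all add: test_approximation_def)
  note H = test_function_Lp[OF \<Omega>(1) p \<gamma> \<phi>]
  have "(\<lambda>n. integral\<^sup>L ?M (\<lambda>z. norm (classical_gradient \<gamma> (\<phi> n) z) powr p)) \<longlonglongrightarrow> integral\<^sup>L ?M (\<lambda>z. norm (G z) powr p)"
    by (rule integral_norm_powr_tendsto[OF p _ _ _ _ lim(2)]) (use G H in \<open>auto simp: Lp_vector_def\<close>)
  moreover have "(\<lambda>n. integral\<^sup>L ?M (\<lambda>z. g z * \<phi> n z)) \<longlonglongrightarrow> integral\<^sup>L ?M (\<lambda>z. g z * u z)"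
    by (rule integral_mult_conjugate_tendsto[OF p refl _ _ _ _ _ _ lim(1)])
       (use g u H in \<open>auto simp: Lp_vector_def Lp_space_def\<close>)
  ultimately show ?thesis
    unfolding test_energy_def
      grushin_energy_eq[OF \<Omega>(1) test_approximation_has_grushin_gradient[OF \<Omega> p \<gamma> ap] G]
    by (intro tendsto_intros)
qed

lemma test_energy_coercive:
  fixes \<Omega> :: "((real ^ 'n) \<times> (real ^ 'l)) set"
  assumes \<Omega>: "open \<Omega>" "bounded \<Omega>" and p: "1 < p" and \<gamma>: "0 \<le> \<gamma>"
    and g: "g \<in> Lp_space (p / (p - 1)) \<Omega>"
  obtains C where "\<And>\<phi>. \<phi> \<in> test_functions \<Omega> \<Longrightarrow>
    1 / (2 * p) * integral\<^sup>L (lebesgue_on \<Omega>) (\<lambda>z. norm (classical_gradient \<gamma> \<phi> z) powr p) \<le> test_energy p \<gamma> \<Omega> g \<phi> + C"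
proof -
  let ?M = "lebesgue_on \<Omega>"
  define q where "q = p / (p - 1)"
  obtain P where P: "0 \<le> P" "\<And>\<phi>. \<phi> \<in> test_functions \<Omega> \<Longrightarrow> integral\<^sup>L ?M (\<lambda>z. \<bar>\<phi> z\<bar> powr p) \<le>
      P * integral\<^sup>L ?M (\<lambda>z. norm (classical_gradient \<gamma> \<phi> z) powr p)"
    using poincare_grushin[OF p \<gamma> \<Omega>] by blast
  \<comment> \<open>with this \<open>\<epsilon>\<close>, the linear term uses at most half of the gradient term\<close>
  define \<epsilon> where "\<epsilon> = 1 / (2 * p * (P + 1))"
  have \<epsilon>0: "0 < \<epsilon>" "\<epsilon> * (P + 1) = 1 / (2 * p)" using p P(1) by (simp_all add: \<epsilon>_def)
  then have \<epsilon>: "0 < \<epsilon>" "\<epsilon> * P \<le> 1 / (2 * p)" by (simp_all add: distrib_left)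
  have "1 / (2 * p) * integral\<^sup>L ?M (\<lambda>z. norm (classical_gradient \<gamma> \<phi> z) powr p) \<le>
      test_energy p \<gamma> \<Omega> g \<phi> + \<epsilon> powr (1 - q) * integral\<^sup>L ?M (\<lambda>z. \<bar>g z\<bar> powr q)"
    if \<phi>: "\<phi> \<in> test_functions \<Omega>" for \<phi>
  proof -
    note H = test_function_Lp[OF \<Omega>(1) p \<gamma> \<phi>]
    let ?A = "integral\<^sup>L ?M (\<lambda>z. norm (classical_gradient \<gamma> \<phi> z) powr p)"
    have A0: "0 \<le> ?A" by (simp add: integral_nonneg_AE)
    have g': "g \<in> borel_measurable ?M" "integrable ?M (\<lambda>z. \<bar>g z\<bar> powr q)"
      using g by (auto simp: Lp_space_def q_def)
    have \<phi>': "\<phi> \<in> borel_measurable ?M" "integrable ?M (\<lambda>z. \<bar>\<phi> z\<bar> powr p)"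
      using H(1) by (auto simp: Lp_vector_def)
    have "integral\<^sup>L ?M (\<lambda>z. g z * \<phi> z) \<le>
        integral\<^sup>L ?M (\<lambda>z. \<epsilon> * \<bar>\<phi> z\<bar> powr p + \<epsilon> powr (1 - q) * \<bar>g z\<bar> powr q)"
    proof (rule integral_mono)
      show "integrable ?M (\<lambda>z. g z * \<phi> z)"
        by (rule integrable_mult_conjugate[OF p q_def \<phi>'(1) g'(1) \<phi>'(2) g'(2)])
      fix z
      show "g z * \<phi> z \<le> \<epsilon> * \<bar>\<phi> z\<bar> powr p + \<epsilon> powr (1 - q) * \<bar>g z\<bar> powr q"
        using mult_le_powr_conjugate(1)[OF p q_def, of "\<bar>g z\<bar>" "\<bar>\<phi> z\<bar>" \<epsilon>] \<epsilon>(1) abs_ge_self[of "g z * \<phi> z"]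
        by (simp add: abs_mult)
    qed (use \<phi>' g' in auto)
    also have "\<dots> = \<epsilon> * integral\<^sup>L ?M (\<lambda>z. \<bar>\<phi> z\<bar> powr p) + \<epsilon> powr (1 - q) * integral\<^sup>L ?M (\<lambda>z. \<bar>g z\<bar> powr q)"
      using \<phi>' g' by simp
    also have "\<epsilon> * integral\<^sup>L ?M (\<lambda>z. \<bar>\<phi> z\<bar> powr p) \<le> \<epsilon> * (P * ?A)"
      using P(2)[OF \<phi>] \<epsilon>(1) by (intro mult_left_mono) auto
    also have "\<epsilon> * (P * ?A) \<le> 1 / (2 * p) * ?A"
      using mult_right_mono[OF \<epsilon>(2) A0] by (simp add: mult.assoc)
    finally have "integral\<^sup>L ?M (\<lambda>z. g z * \<phi> z) \<le>
        1 / (2 * p) * ?A + \<epsilon> powr (1 - q) * integral\<^sup>L ?M (\<lambda>z. \<bar>g z\<bar> powr q)" by simp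
    moreover have "1 / p * ?A = 1 / (2 * p) * ?A + 1 / (2 * p) * ?A"
      using p by (simp add: field_simps)
    ultimately show ?thesis unfolding test_energy_def by linarith
  qed
  then show ?thesis by (rule that)
qed

text \<open>
  Up to the factor \<open>p\<close>, the convexity defect of the energy at a midpoint is that of the integral of the
  \<open>p\<close>-th power of the norm of the gradient, because the remaining term is linear.
\<close>

lemma test_energy_midpoint:
  assumes \<Omega>: "open \<Omega>" and p: "1 < p" and \<gamma>: "0 \<le> \<gamma>" and g: "g \<in> Lp_space (p / (p - 1)) \<Omega>"
    and \<phi>: "\<phi> \<in> test_functions \<Omega>" and \<psi>: "\<psi> \<in> test_functions \<Omega>"
  shows "(integral\<^sup>L (lebesgue_on \<Omega>) (\<lambda>z. norm (classical_gradient \<gamma> \<phi> z) powr p) +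
      integral\<^sup>L (lebesgue_on \<Omega>) (\<lambda>z. norm (classical_gradient \<gamma> \<psi> z) powr p)) / 2 -
    integral\<^sup>L (lebesgue_on \<Omega>) (\<lambda>z. norm ((1/2) *\<^sub>R (classical_gradient \<gamma> \<phi> z + classical_gradient \<gamma> \<psi> z)) powr p) =
    p * ((test_energy p \<gamma> \<Omega> g \<phi> + test_energy p \<gamma> \<Omega> g \<psi>) / 2 -
      test_energy p \<gamma> \<Omega> g (\<lambda>z. 1/2 * \<phi> z + 1/2 * \<psi> z))"
proof -
  let ?M = "lebesgue_on \<Omega>"
  have i: "integrable ?M (\<lambda>z. g z * \<phi> z)" if "\<phi> \<in> test_functions \<Omega>" for \<phi>
    by (rule integrable_mult_conjugate[OF p refl])
       (use test_function_Lp(1)[OF \<Omega> p \<gamma> that] g in \<open>auto simp: Lp_vector_def Lp_space_def\<close>)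
  have "integral\<^sup>L ?M (\<lambda>z. g z * (1/2 * \<phi> z + 1/2 * \<psi> z)) =
      integral\<^sup>L ?M (\<lambda>z. 1/2 * (g z * \<phi> z) + 1/2 * (g z * \<psi> z))"
    by (simp add: algebra_simps)
  also have "\<dots> = 1/2 * integral\<^sup>L ?M (\<lambda>z. g z * \<phi> z) + 1/2 * integral\<^sup>L ?M (\<lambda>z. g z * \<psi> z)"
    using i[OF \<phi>] i[OF \<psi>] by simp
  finally show ?thesis
    using p unfolding test_energy_def classical_gradient_linear_combination[OF \<phi> \<psi>] scaleR_add_right[symmetric]
    by (simp add: field_simps)
qed

text \<open>
  Coercivity bounds the \<open>p\<close>-th powers of the \<open>L\<^sup>p\<close> norms of the gradients by some \<open>B\<close>. Integrated
  uniform convexity then bounds the \<open>p\<close>-th power of the distance of two gradients by \<open>\<epsilon>\<close> times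
  \<open>2 * B\<close> plus a multiple of the convexity defect, which tends to \<open>0\<close> because no midpoint has an
  energy below \<open>J\<close>.
\<close>

lemma minimizing_sequence_cauchy:
  fixes \<phi> :: "nat \<Rightarrow> (real ^ 'n) \<times> (real ^ 'l) \<Rightarrow> real"
  assumes \<Omega>: "open \<Omega>" "bounded \<Omega>" and p: "1 < p" and \<gamma>: "0 \<le> \<gamma>"
    and g: "g \<in> Lp_space (p / (p - 1)) \<Omega>"
    and \<phi>: "\<And>n. \<phi> n \<in> test_functions \<Omega>"
    and J: "\<And>\<psi>. \<psi> \<in> test_functions \<Omega> \<Longrightarrow> J \<le> test_energy p \<gamma> \<Omega> g \<psi>"
      "\<And>n. test_energy p \<gamma> \<Omega> g (\<phi> n) \<le> J + inverse (real (Suc n))"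
    and e: "0 < e"
  shows "\<exists>N. \<forall>m\<ge>N. \<forall>n\<ge>N. integral\<^sup>L (lebesgue_on \<Omega>)
    (\<lambda>z. norm (classical_gradient \<gamma> (\<phi> m) z - classical_gradient \<gamma> (\<phi> n) z) powr p) < e"
proof -
  let ?M = "lebesgue_on \<Omega>"
  let ?G = "\<lambda>n. classical_gradient \<gamma> (\<phi> n)"
  define A where "A n = integral\<^sup>L ?M (\<lambda>z. norm (?G n z) powr p)" for n
  note G = test_function_Lp(2)[OF \<Omega>(1) p \<gamma> \<phi>]
  obtain C where C: "\<And>\<phi>. \<phi> \<in> test_functions \<Omega> \<Longrightarrow>
      1 / (2 * p) * integral\<^sup>L ?M (\<lambda>z. norm (classical_gradient \<gamma> \<phi> z) powr p) \<le> test_energy p \<gamma> \<Omega> g \<phi> + C"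
    using test_energy_coercive[OF \<Omega> p \<gamma> g] by blast
  define B where "B = 2 * p * (J + 1 + C)"
  have A0: "0 \<le> A n" for n by (simp add: A_def integral_nonneg_AE)
  have AB: "A n \<le> B" for n
  proof -
    have "inverse (real (Suc n)) \<le> 1" by (simp add: field_simps)
    then have "1 / (2 * p) * A n \<le> J + 1 + C"
      using C[OF \<phi>, of n] J(2)[of n] unfolding A_def by linarith
    then show ?thesis using p by (simp add: B_def field_simps)
  qed
  have B0: "0 \<le> B" using A0[of 0] AB[of 0] by linarith
  define \<epsilon> where "\<epsilon> = e / (4 * (B + 1))"
  have \<epsilon>0: "0 < \<epsilon>" "\<epsilon> * (4 * (B + 1)) = e" using e B0 by (simp_all add: \<epsilon>_def)
  then have \<epsilon>: "\<epsilon> * (2 * B) < e / 2" by (simp add: algebra_simps)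
  obtain K where K: "0 \<le> K" "\<And>a b :: (real ^ 'n) \<times> (real ^ 'l).
      norm (a - b) powr p \<le> \<epsilon> * (norm a powr p + norm b powr p) +
      K * ((norm a powr p + norm b powr p) / 2 - norm ((1/2) *\<^sub>R (a + b)) powr p)"
    using norm_powr_uniformly_convex[OF p \<epsilon>0(1)] by blast
  have "(\<lambda>n. K * p * inverse (real (Suc n))) \<longlonglongrightarrow> K * p * 0"
    by (intro tendsto_intros LIMSEQ_inverse_real_of_nat)
  then have "\<forall>\<^sub>F n in sequentially. K * p * inverse (real (Suc n)) < e / 2"
    using e by (intro order_tendstoD(2)) auto
  then obtain N where N: "K * p * inverse (real (Suc N)) < e / 2"
    using eventually_happens'[OF sequentially_bot] by blast
  have "integral\<^sup>L ?M (\<lambda>z. norm (?G m z - ?G n z) powr p) < e" if mn: "N \<le> m" "N \<le> n" for m n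
  proof -
    let ?mid = "\<lambda>z. (1/2) *\<^sub>R (?G m z + ?G n z)"
    have mid: "?mid \<in> Lp_vector p \<Omega>"
      by (rule Lp_vector_scaleR[OF Lp_vector_add(1)[OF p G G]])
    have diff: "(\<lambda>z. ?G m z - ?G n z) \<in> Lp_vector p \<Omega>"
      by (rule Lp_vector_add(2)[OF p G G])
    have int: "integrable ?M (\<lambda>z. norm (?G m z) powr p)" "integrable ?M (\<lambda>z. norm (?G n z) powr p)"
      "integrable ?M (\<lambda>z. norm (?mid z) powr p)" "integrable ?M (\<lambda>z. norm (?G m z - ?G n z) powr p)"
      using G[of m] G[of n] mid diff unfolding Lp_vector_def by blast+
    define D where "D = (A m + A n) / 2 - integral\<^sup>L ?M (\<lambda>z. norm (?mid z) powr p)"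
    have "integral\<^sup>L ?M (\<lambda>z. norm (?G m z - ?G n z) powr p) \<le>
        integral\<^sup>L ?M (\<lambda>z. \<epsilon> * (norm (?G m z) powr p + norm (?G n z) powr p) +
          K * ((norm (?G m z) powr p + norm (?G n z) powr p) / 2 - norm (?mid z) powr p))"
      by (rule integral_mono[OF int(4) _ K(2)])
         (intro Bochner_Integration.integrable_add Bochner_Integration.integrable_diff
            integrable_mult_right integrable_divide int)
    also have "\<dots> = \<epsilon> * (A m + A n) + K * D"
      unfolding A_def D_def using int(1-3)
      by (simp add: Bochner_Integration.integral_add Bochner_Integration.integral_diff del: scaleR_add_right norm_scaleR)
    also have "\<epsilon> * (A m + A n) \<le> \<epsilon> * (2 * B)"
      using \<epsilon>0(1) AB[of m] AB[of n] by (intro mult_left_mono) auto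
    also have "K * D \<le> K * (p * inverse (real (Suc N)))"
    proof (rule mult_left_mono[OF _ K(1)])
      define \<delta> where "\<delta> = inverse (real (Suc N))"
      define E where "E = test_energy p \<gamma> \<Omega> g (\<lambda>z. 1/2 * \<phi> m z + 1/2 * \<phi> n z)"
      have J\<delta>: "test_energy p \<gamma> \<Omega> g (\<phi> k) \<le> J + \<delta>" if "N \<le> k" for k
        using that by (intro order_trans[OF J(2)[of k]] add_left_mono) (auto simp: \<delta>_def intro!: le_imp_inverse_le)
      have "J \<le> E"
        unfolding E_def by (rule J(1)[OF test_function_linear_combination(1)[OF \<phi> \<phi>]])
      then have "test_energy p \<gamma> \<Omega> g (\<phi> m) + test_energy p \<gamma> \<Omega> g (\<phi> n) \<le> (E + \<delta>) + (E + \<delta>)"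
        by (intro add_mono order_trans[OF J\<delta>[OF mn(1)]] order_trans[OF J\<delta>[OF mn(2)]]) simp_all
      then have "(test_energy p \<gamma> \<Omega> g (\<phi> m) + test_energy p \<gamma> \<Omega> g (\<phi> n)) / 2 - E \<le> \<delta>"
        by (simp add: field_simps)
      then show "D \<le> p * inverse (real (Suc N))"
        using p unfolding D_def A_def test_energy_midpoint[OF \<Omega>(1) p \<gamma> g \<phi> \<phi>] E_def \<delta>_def
        by (intro mult_left_mono) auto
    qed
    finally show ?thesis using \<epsilon> N by (simp add: mult.assoc)
  qed
  then show ?thesis by blast
qed

text \<open>
  By the Poincare inequality, convergence of the gradients alone already gives a limit in \<open>W0_space\<close>.
\<close>

lemma cauchy_gradients_test_approximation:
  fixes \<phi> :: "nat \<Rightarrow> (real ^ 'n) \<times> (real ^ 'l) \<Rightarrow> real"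
  assumes \<Omega>: "open \<Omega>" "bounded \<Omega>" and p: "1 < p" and \<gamma>: "0 \<le> \<gamma>"
    and \<phi>: "\<And>n. \<phi> n \<in> test_functions \<Omega>"
    and cauchy: "\<And>e. 0 < e \<Longrightarrow> \<exists>N. \<forall>m\<ge>N. \<forall>n\<ge>N. integral\<^sup>L (lebesgue_on \<Omega>)
      (\<lambda>z. norm (classical_gradient \<gamma> (\<phi> m) z - classical_gradient \<gamma> (\<phi> n) z) powr p) < e"
  obtains u G where "test_approximation p \<gamma> \<Omega> u G \<phi>"
proof -
  let ?M = "lebesgue_on \<Omega>"
  let ?G = "\<lambda>n. classical_gradient \<gamma> (\<phi> n)"
  interpret finite_measure ?M
    by (rule finite_measure_lebesgue_on[OF lmeasurable_open[OF \<Omega>(2,1)]])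
  note L = test_function_Lp[OF \<Omega>(1) p \<gamma> \<phi>]
  obtain P where P: "0 \<le> P" "\<And>\<phi>. \<phi> \<in> test_functions \<Omega> \<Longrightarrow> integral\<^sup>L ?M (\<lambda>z. \<bar>\<phi> z\<bar> powr p) \<le>
      P * integral\<^sup>L ?M (\<lambda>z. norm (classical_gradient \<gamma> \<phi> z) powr p)"
    using poincare_grushin[OF p \<gamma> \<Omega>] by blast
  \<comment> \<open>completeness is applied once, to the pairs of function and gradient\<close>
  define f where "f n z = (\<phi> n z, ?G n z)" for n z
  define d where "d m n = integral\<^sup>L ?M (\<lambda>z. norm (?G m z - ?G n z) powr p)" for m n
  have norm_le: "norm (x, y) powr p \<le> 2 powr p * (\<bar>x\<bar> powr p + norm y powr p)"
    for x :: real and y :: "(real ^ 'n) \<times> (real ^ 'l)"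
    using norm_add_powr_le(1)[of p "(x, 0)" "(0, y)"] p by (simp add: norm_prod_def)
  have int: "integrable ?M (\<lambda>z. \<bar>\<phi> n z\<bar> powr p)" "integrable ?M (\<lambda>z. norm (?G n z) powr p)"
    and [measurable]: "\<phi> n \<in> borel_measurable ?M" "?G n \<in> borel_measurable ?M" for n
    using L[of n] by (auto simp: Lp_vector_def)
  have intd: "integrable ?M (\<lambda>z. \<bar>\<phi> m z - \<phi> n z\<bar> powr p)" "integrable ?M (\<lambda>z. norm (?G m z - ?G n z) powr p)" for m n
    using Lp_vector_add(2)[OF p L(1)[of m] L(1)[of n]] Lp_vector_add(2)[OF p L(2)[of m] L(2)[of n]]
    by (auto simp: Lp_vector_def)
  have fm[measurable]: "f n \<in> borel_measurable ?M" for n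
    unfolding f_def by (intro borel_measurable_Pair) measurable
  have fi: "integrable ?M (\<lambda>z. norm (f n z) powr p)" for n
  proof (rule Bochner_Integration.integrable_bound)
    show "integrable ?M (\<lambda>z. 2 powr p * (\<bar>\<phi> n z\<bar> powr p + norm (?G n z) powr p))" using int by simp
    show "AE z in ?M. norm (norm (f n z) powr p) \<le> norm (2 powr p * (\<bar>\<phi> n z\<bar> powr p + norm (?G n z) powr p))"
      using norm_le by (auto simp: f_def intro!: AE_I2 order_trans[OF _ abs_ge_self])
  qed measurable
  have fd: "integral\<^sup>L ?M (\<lambda>z. norm (f m z - f n z) powr p) \<le> 2 powr p * (P + 1) * d m n" for m n
  proof -
    have "integral\<^sup>L ?M (\<lambda>z. norm (f m z - f n z) powr p) \<le>
        integral\<^sup>L ?M (\<lambda>z. 2 powr p * (\<bar>\<phi> m z - \<phi> n z\<bar> powr p + norm (?G m z - ?G n z) powr p))"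
      by (rule integral_mono[OF integrable_norm_powr_add(2)[OF p fm fm fi fi]])
         (use intd norm_le in \<open>auto simp: f_def\<close>)
    also have "\<dots> = 2 powr p * (integral\<^sup>L ?M (\<lambda>z. \<bar>\<phi> m z - \<phi> n z\<bar> powr p) + d m n)"
      using intd by (simp add: d_def)
    also have "\<dots> \<le> 2 powr p * (P * d m n + d m n)"
    proof -
      have "integral\<^sup>L ?M (\<lambda>z. \<bar>1 * \<phi> m z + (- 1) * \<phi> n z\<bar> powr p) \<le>
          P * integral\<^sup>L ?M (\<lambda>z. norm (1 *\<^sub>R ?G m z + (- 1) *\<^sub>R ?G n z) powr p)"
        unfolding classical_gradient_linear_combination[OF \<phi> \<phi>, symmetric]
        by (rule P(2)[OF test_function_linear_combination(1)[OF \<phi> \<phi>]])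
      then show ?thesis by (intro mult_left_mono add_right_mono) (simp_all add: d_def)
    qed
    finally show ?thesis by (simp add: algebra_simps)
  qed
  have cf: "\<exists>N. \<forall>m\<ge>N. \<forall>n\<ge>N. integral\<^sup>L ?M (\<lambda>z. norm (f m z - f n z) powr p) < e" if e: "0 < e" for e
  proof -
    have pos: "0 < 2 powr p * (P + 1)" using P(1) by simp
    obtain N where N: "\<And>m n. N \<le> m \<Longrightarrow> N \<le> n \<Longrightarrow> d m n < e / (2 powr p * (P + 1))"
      using cauchy[of "e / (2 powr p * (P + 1))"] e pos unfolding d_def by (meson divide_pos_pos)
    have "integral\<^sup>L ?M (\<lambda>z. norm (f m z - f n z) powr p) < e" if "N \<le> m" "N \<le> n" for m n
    proof -
      have "2 powr p * (P + 1) * d m n < e"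
        using N[OF that] pos by (simp add: pos_less_divide_eq mult.commute)
      with fd[of m n] show ?thesis by linarith
    qed
    then show ?thesis by blast
  qed
  obtain w where w: "w \<in> borel_measurable ?M" "integrable ?M (\<lambda>z. norm (w z) powr p)"
      "\<And>n. integrable ?M (\<lambda>z. norm (f n z - w z) powr p)"
      "(\<lambda>n. integral\<^sup>L ?M (\<lambda>z. norm (f n z - w z) powr p)) \<longlonglongrightarrow> 0"
    using powr_norm_complete[of p f, OF p fm fi cf] by blast
  note [measurable] = w(1)
  have wL: "w \<in> Lp_vector p \<Omega>" using w by (simp add: Lp_vector_def)
  have u: "(\<lambda>z. fst (w z)) \<in> Lp_vector p \<Omega>"
    by (rule Lp_vector_bounded[OF _ wL borel_measurable_continuous_on[OF _ w(1)] norm_fst_le_norm])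
       (use p in \<open>auto intro: continuous_intros\<close>)
  have G: "(\<lambda>z. snd (w z)) \<in> Lp_vector p \<Omega>"
    by (rule Lp_vector_bounded[OF _ wL borel_measurable_continuous_on[OF _ w(1)] norm_snd_le_norm])
       (use p in \<open>auto intro: continuous_intros\<close>)
  have "(\<lambda>n. integral\<^sup>L ?M (\<lambda>z. norm (\<phi> n z - fst (w z)) powr p)) \<longlonglongrightarrow> 0"
  proof (rule real_tendsto_sandwich[OF _ _ tendsto_const w(4)])
    have "norm (\<phi> n z - fst (w z)) powr p \<le> norm (f n z - w z) powr p" for n z
      using norm_fst_le_norm[of "f n z - w z"] p by (intro powr_mono2) (auto simp: f_def)
    then have "integral\<^sup>L ?M (\<lambda>z. norm (\<phi> n z - fst (w z)) powr p) \<le> integral\<^sup>L ?M (\<lambda>z. norm (f n z - w z) powr p)" for n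
      using Lp_vector_add(2)[OF p L(1) u, of n] w(3)[of n] by (intro integral_mono) (auto simp: Lp_vector_def)
    then show "\<forall>\<^sub>F n in sequentially. integral\<^sup>L ?M (\<lambda>z. norm (\<phi> n z - fst (w z)) powr p) \<le> integral\<^sup>L ?M (\<lambda>z. norm (f n z - w z) powr p)"
      by simp
  qed (simp add: integral_nonneg_AE)
  moreover have "(\<lambda>n. integral\<^sup>L ?M (\<lambda>z. norm (?G n z - snd (w z)) powr p)) \<longlonglongrightarrow> 0"
  proof (rule real_tendsto_sandwich[OF _ _ tendsto_const w(4)])
    have "norm (?G n z - snd (w z)) powr p \<le> norm (f n z - w z) powr p" for n z
      using norm_snd_le_norm[of "f n z - w z"] p by (intro powr_mono2) (auto simp: f_def)
    then have "integral\<^sup>L ?M (\<lambda>z. norm (?G n z - snd (w z)) powr p) \<le> integral\<^sup>L ?M (\<lambda>z. norm (f n z - w z) powr p)" for n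
      using Lp_vector_add(2)[OF p L(2) G, of n] w(3)[of n] by (intro integral_mono) (auto simp: Lp_vector_def)
    then show "\<forall>\<^sub>F n in sequentially. integral\<^sup>L ?M (\<lambda>z. norm (?G n z - snd (w z)) powr p) \<le> integral\<^sup>L ?M (\<lambda>z. norm (f n z - w z) powr p)"
      by simp
  qed (simp add: integral_nonneg_AE)
  ultimately have "test_approximation p \<gamma> \<Omega> (\<lambda>z. fst (w z)) (\<lambda>z. snd (w z)) \<phi>"
    using u G \<phi> by (simp add: test_approximation_def)
  then show ?thesis by (rule that)
qed

theorem lemma1p1:
  fixes p pstar \<gamma> :: real
    and \<Omega> :: "((real ^ 'n) \<times> (real ^ 'l)) set"
    and g :: "(real ^ 'n) \<times> (real ^ 'l) \<Rightarrow> real"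
  assumes "p > 1" and "pstar = p / (p - 1)" and "\<gamma> \<ge> 0"
    and "CARD('n) + CARD('l) \<ge> 3"
    and "open \<Omega>" and "connected \<Omega>" and "\<Omega> \<noteq> {}" and "bounded \<Omega>"
    and "g \<in> Lp_space pstar \<Omega>"
  shows "\<exists>u \<in> W0_space p \<gamma> \<Omega>.
    ereal (grushin_energy p \<gamma> \<Omega> g u) = (INF v \<in> W0_space p \<gamma> \<Omega>. ereal (grushin_energy p \<gamma> \<Omega> g v))"
proof -
  note p = assms(1) and \<gamma> = assms(3) and \<Omega> = assms(5,8)
  have g: "g \<in> Lp_space (p / (p - 1)) \<Omega>" using assms(2,9) by simp
  let ?T = "test_functions \<Omega>"
  let ?E = "test_energy p \<gamma> \<Omega> g"
  obtain C where C: "\<And>\<phi>. \<phi> \<in> ?T \<Longrightarrow>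
      1 / (2 * p) * integral\<^sup>L (lebesgue_on \<Omega>) (\<lambda>z. norm (classical_gradient \<gamma> \<phi> z) powr p) \<le> ?E \<phi> + C"
    using test_energy_coercive[OF \<Omega> p \<gamma> g] by blast
  have lower: "- C \<le> ?E \<phi>" if "\<phi> \<in> ?T" for \<phi>
  proof -
    have "0 \<le> 1 / (2 * p) * integral\<^sup>L (lebesgue_on \<Omega>) (\<lambda>z. norm (classical_gradient \<gamma> \<phi> z) powr p)"
      using p by (simp add: integral_nonneg_AE)
    with C[OF that] show ?thesis by linarith
  qed
  define J where "J = Inf (?E ` ?T)"
  have bdd: "bdd_below (?E ` ?T)" using lower by (auto intro!: bdd_belowI)
  have "(\<lambda>_. 0) \<in> ?T" by (simp add: test_functions_def Ck_const)
  then have ne: "?E ` ?T \<noteq> {}" by blast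
  have J: "J \<le> ?E \<phi>" if "\<phi> \<in> ?T" for \<phi>
    unfolding J_def using that by (intro cInf_lower bdd) auto
  have "\<forall>n. \<exists>\<phi>. \<phi> \<in> ?T \<and> ?E \<phi> < J + inverse (real (Suc n))"
  proof
    fix n
    have "Inf (?E ` ?T) < J + inverse (real (Suc n))" by (simp add: J_def)
    from cInf_lessD[OF ne this] show "\<exists>\<phi>. \<phi> \<in> ?T \<and> ?E \<phi> < J + inverse (real (Suc n))" by blast
  qed
  from choice[OF this] obtain \<phi> where \<phi>: "\<And>n. \<phi> n \<in> ?T" "\<And>n. ?E (\<phi> n) < J + inverse (real (Suc n))"
    by blast
  obtain u G where ap: "test_approximation p \<gamma> \<Omega> u G \<phi>"
    using cauchy_gradients_test_approximation[OF \<Omega> p \<gamma> \<phi>(1)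
        minimizing_sequence_cauchy[OF \<Omega> p \<gamma> g \<phi>(1) J less_imp_le[OF \<phi>(2)]]] by blast
  have u: "u \<in> W0_space p \<gamma> \<Omega>"
    unfolding W0_space_iff_test_approximation[OF \<Omega> p \<gamma>] using ap by blast
  have "grushin_energy p \<gamma> \<Omega> g u \<le> J"
  proof (rule LIMSEQ_le[OF test_energy_tendsto[OF \<Omega> p \<gamma> g ap]])
    show "(\<lambda>n. J + inverse (real (Suc n))) \<longlonglongrightarrow> J"
      using tendsto_add[OF tendsto_const LIMSEQ_inverse_real_of_nat, of J] by simp
    show "\<exists>N. \<forall>n\<ge>N. ?E (\<phi> n) \<le> J + inverse (real (Suc n))"
      using \<phi>(2) by (auto intro: less_imp_le)
  qed
  moreover have "J \<le> grushin_energy p \<gamma> \<Omega> g v" if v: "v \<in> W0_space p \<gamma> \<Omega>" for v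
  proof -
    obtain H \<psi> where ap': "test_approximation p \<gamma> \<Omega> v H \<psi>"
      using v unfolding W0_space_iff_test_approximation[OF \<Omega> p \<gamma>] by blast
    then have "J \<le> ?E (\<psi> n)" for n
      by (intro J) (simp add: test_approximation_def)
    then show ?thesis
      by (intro LIMSEQ_le_const[OF test_energy_tendsto[OF \<Omega> p \<gamma> g ap']]) auto
  qed
  ultimately have "ereal (grushin_energy p \<gamma> \<Omega> g u) \<le> ereal (grushin_energy p \<gamma> \<Omega> g v)"
    if "v \<in> W0_space p \<gamma> \<Omega>" for v
    using that by (auto intro: order_trans)
  then have "ereal (grushin_energy p \<gamma> \<Omega> g u) = (INF v \<in> W0_space p \<gamma> \<Omega>. ereal (grushin_energy p \<gamma> \<Omega> g v))"
    by (intro antisym INF_greatest INF_lower u)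
  with u show ?thesis by blast
qed

end
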